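(* Let $P$ be a finite graded poset of rank $n$ and let $a,b,\ell$ be positive integers. Then there is a bijection $\Psi:\mathcal{L}_{(P\times[a])\times[\ell]}(R^{a+b+n})\to\mathcal{L}_{(P\times[b])\times[\ell]}(R^{a+b+n})$ with $\Psi\circ\mathrm{Pro}=\mathrm{Pro}\circ\Psi$.
   Context: A finite poset is graded of rank $n$ if every maximal chain has $n+1$ elements. $P\times[a]$ has the product order. For a finite poset $Q$ and positive integer $\ell$, let $[\ell]=\{1<\dots<\ell\}$ and for $p\in Q$ let the fiber be $F_p=\{(p,i):1\le i\le \ell\}$. Given $R$ assigning to each $p\in Q$ a finite nonempty set $R(p)\subset\mathbb{Z}$, a $Q$-strict labeling of $Q\times[\ell]$ with restriction function $R$ is a map $f:Q\times[\ell]\to\mathbb{Z}$ with (1) $f(p_1,i)<f(p_2,i)$ whenever $p_1<_Q p_2$; (2) $f(p,i_1)\le f(p,i_2)$ whenever $i_1\le i_2$; (3) $f(p,i)\in R(p)$. The set of these is $\mathcal{L}_{Q\times[\ell]}(R)$. For a positive integer $q$, $R^q(p)$ is the set of $k$ such that some map $g:Q\to\{1,\dots,q\}$ with $g(p_1)<g(p_2)$ whenever $p_1<_Qp_2$ has $g(p)=k$. Promotion: let $R(p)_{>k}$ be the smallest element of $R(p)$ larger than $k$. A label $f(p,i)$ is raisable (resp. lowerable) if there is $g\in\mathcal{L}_{Q\times[\ell]}(R)$ with $f(p,i)<g(p,i)$ (resp. $>$) and $f(p',i')=g(p',i')$ for all $(p',i')$ with $p'\neq p$. The Bender–Knuth involution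 $\rho_k$: call raisable labels equal to $k$ and lowerable labels equal to $R(p)_{>k}$ free; if the free labels in fiber $F_p$ are $\alpha$ copies of $k$ followed by $\beta$ copies of $R(p)_{>k}$, $\rho_k$ replaces them by $\beta$ copies of $k$ followed by $\alpha$ copies of $R(p)_{>k}$. Promotion is $\mathrm{Pro}=\cdots\circ\rho_2\circ\rho_1\circ\cdots$ (applied in increasing order of $k$; only finitely many act nontrivially). *)

theory Defs
  imports Main "HOL-Library.FuncSet" "HOL-Library.Product_Order"
begin

text \<open>
  A finite poset is a finite subset of a type of class \<open>order\<close> with the induced order.
  \<open>[a]\<close> is \<open>{1..a}\<close>, and \<open>P \<times> {1..a}\<close> carries the componentwise order of
  \<open>HOL-Library.Product_Order\<close>.
\<close>

definition graded_of_rank :: "'a::order set \<Rightarrow> nat \<Rightarrow> bool" where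
  "graded_of_rank P n \<longleftrightarrow> (\<forall>C. pred_on.maxchain P (<) C \<longrightarrow> card C = n + 1)"

text \<open>
  Labelings are extensional functions (\<open>undefined\<close> off \<open>Q \<times> {1..l}\<close>), so that distinct elements
  of \<open>strict_labelings Q l R\<close> are distinct labelings.
\<close>

definition strict_labelings ::
    "'q::order set \<Rightarrow> nat \<Rightarrow> ('q \<Rightarrow> int set) \<Rightarrow> ('q \<times> nat \<Rightarrow> int) set" where
  "strict_labelings Q l R =
     {f \<in> extensional (Q \<times> {1..l}).
        (\<forall>p1\<in>Q. \<forall>p2\<in>Q. \<forall>i\<in>{1..l}. p1 < p2 \<longrightarrow> f (p1, i) < f (p2, i)) \<and>
        (\<forall>p\<in>Q. \<forall>i1\<in>{1..l}. \<forall>i2\<in>{1..l}. i1 \<le> i2 \<longrightarrow> f (p, i1) \<le> f (p, i2)) \<and>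
        (\<forall>p\<in>Q. \<forall>i\<in>{1..l}. f (p, i) \<in> R p)}"

definition restriction_upto :: "'q::order set \<Rightarrow> nat \<Rightarrow> 'q \<Rightarrow> int set" where
  "restriction_upto Q q p =
     {k. \<exists>g. (\<forall>x\<in>Q. g x \<in> {1..int q}) \<and>
             (\<forall>x\<in>Q. \<forall>y\<in>Q. x < y \<longrightarrow> g x < g y) \<and> g p = k}"

text \<open>\<open>R(p)_{>k}\<close>; meaningful only if \<open>R p\<close> is finite and has an element above \<open>k\<close>.\<close>

definition next_label :: "('q \<Rightarrow> int set) \<Rightarrow> 'q \<Rightarrow> int \<Rightarrow> int" where
  "next_label R p k = Min {m \<in> R p. k < m}"

definition raisable ::
    "'q::order set \<Rightarrow> nat \<Rightarrow> ('q \<Rightarrow> int set) \<Rightarrow> ('q \<times> nat \<Rightarrow> int) \<Rightarrow> 'q \<Rightarrow> nat \<Rightarrow> bool" where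
  "raisable Q l R f p i \<longleftrightarrow>
     (\<exists>g\<in>strict_labelings Q l R. f (p, i) < g (p, i) \<and>
        (\<forall>p'\<in>Q. \<forall>i'\<in>{1..l}. p' \<noteq> p \<longrightarrow> f (p', i') = g (p', i')))"

definition lowerable ::
    "'q::order set \<Rightarrow> nat \<Rightarrow> ('q \<Rightarrow> int set) \<Rightarrow> ('q \<times> nat \<Rightarrow> int) \<Rightarrow> 'q \<Rightarrow> nat \<Rightarrow> bool" where
  "lowerable Q l R f p i \<longleftrightarrow>
     (\<exists>g\<in>strict_labelings Q l R. f (p, i) > g (p, i) \<and>
        (\<forall>p'\<in>Q. \<forall>i'\<in>{1..l}. p' \<noteq> p \<longrightarrow> f (p', i') = g (p', i')))"

text \<open>
  Positions of the free labels of the fiber over \<open>p\<close>. A fiber takes part in the \<open>k\<close>-th involution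
  only if both \<open>k\<close> and a larger label are allowed on it: otherwise there is nothing to exchange,
  and writing \<open>k\<close> into the fiber would violate the restriction function. For
  \<open>restriction_upto Q q\<close>, whose values are intervals, no label is free in the excluded cases anyway.
\<close>

definition free_low ::
    "'q::order set \<Rightarrow> nat \<Rightarrow> ('q \<Rightarrow> int set) \<Rightarrow> int \<Rightarrow> ('q \<times> nat \<Rightarrow> int) \<Rightarrow> 'q \<Rightarrow> nat set" where
  "free_low Q l R k f p =
     {i \<in> {1..l}. k \<in> R p \<and> (\<exists>m\<in>R p. k < m) \<and>
        f (p, i) = k \<and> raisable Q l R f p i}"

definition free_high ::
    "'q::order set \<Rightarrow> nat \<Rightarrow> ('q \<Rightarrow> int set) \<Rightarrow> int \<Rightarrow> ('q \<times> nat \<Rightarrow> int) \<Rightarrow> 'q \<Rightarrow> nat set" where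
  "free_high Q l R k f p =
     {i \<in> {1..l}. k \<in> R p \<and> (\<exists>m\<in>R p. k < m) \<and>
        f (p, i) = next_label R p k \<and> lowerable Q l R f p i}"

text \<open>
  In every fiber, the free positions are refilled from left to right with
  \<open>card (free_high \<dots>)\<close> copies of \<open>k\<close>, then copies of \<open>R(p)_{>k}\<close>. The test on
  \<open>card {j \<in> F. j < i}\<close> picks out the first \<open>card (free_high \<dots>)\<close> elements of the set \<open>F\<close> of
  free positions.
\<close>

definition bender_knuth ::
    "'q::order set \<Rightarrow> nat \<Rightarrow> ('q \<Rightarrow> int set) \<Rightarrow> int \<Rightarrow> ('q \<times> nat \<Rightarrow> int) \<Rightarrow> 'q \<times> nat \<Rightarrow> int" where
  "bender_knuth Q l R k f = (\<lambda>(p, i).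
     let F = free_low Q l R k f p \<union> free_high Q l R k f p in
     if p \<in> Q \<and> i \<in> F
     then if card {j \<in> F. j < i} < card (free_high Q l R k f p) then k else next_label R p k
     else f (p, i))"

lemma bender_knuth_trivial:
  assumes "k \<notin> (\<Union>p\<in>Q. R p)"
  shows "bender_knuth Q l R k f = f"
  using assms by (auto simp: bender_knuth_def free_low_def free_high_def fun_eq_iff)

text \<open>
  The composition over all integers \<open>k\<close> reduces to the range of labels that occur in \<open>R\<close>, by
  \<open>bender_knuth_trivial\<close>. The list \<open>[lo..hi]\<close> is increasing and \<open>fold\<close> applies the
  involution of its first element first.
\<close>

definition promotion ::
    "'q::order set \<Rightarrow> nat \<Rightarrow> ('q \<Rightarrow> int set) \<Rightarrow> ('q \<times> nat \<Rightarrow> int) \<Rightarrow> 'q \<times> nat \<Rightarrow> int" where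
  "promotion Q l R =
     fold (bender_knuth Q l R) [Min (\<Union>p\<in>Q. R p)..Max (\<Union>p\<in>Q. R p)]"

end

theory Submission
  imports Defs
begin

text \<open>
  Let \<open>Q\<close> be graded of rank \<open>N\<close> and \<open>q = N + 1 + b\<close>. Then the labels allowed at \<open>x\<close> are
  \<open>r x + 1, \<dots>, r x + 1 + b\<close>, and a labeling is determined by the numbers
  \<open>G (x, j)\<close> of labels in the fiber over \<open>x\<close> that exceed \<open>r x + 1 + b - j\<close>, for \<open>1 \<le> j \<le> b\<close>.
  These \<open>G\<close> are exactly the order-preserving maps \<open>Q \<times> [b] \<rightarrow> {0..l}\<close>, and the \<open>k\<close>-th
  Bender-Knuth involution becomes the simultaneous piecewise-linear toggle at all \<open>(x, j)\<close> with
  \<open>r x + 1 + b - j = k\<close>. So for \<open>Q = P \<times> [a]\<close> and for \<open>Q = P \<times> [b]\<close> promotion is a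
  product of all the toggles on the same poset \<open>P \<times> [a] \<times> [b]\<close>, only taken in different orders:
  by increasing height \<open>r p + i - j\<close> in the first case, \<open>r p + j - i\<close> in the second. Both heights
  change by exactly one along covers and differ by an even number (up to a constant). Raising the
  height of a local minimum \<open>e\<close> by two moves the toggle at \<open>e\<close> from the front to the back of the product,
  that is, conjugates it by that toggle; finitely many such moves lead from one height to the other.
\<close>

section \<open>Piecewise-linear toggles\<close>

text \<open>Reflects each value on \<open>X\<close> in the interval that its neighbours leave open.
  All neighbours are read from the old \<open>G\<close>, so the toggles act simultaneously. The
  inserted \<open>l\<close> and \<open>0\<close> act as the values at an adjoined top and
  bottom.\<close>

definition toggle :: "('e \<Rightarrow> 'e \<Rightarrow> bool) \<Rightarrow> int \<Rightarrow> 'e set \<Rightarrow> ('e \<Rightarrow> int) \<Rightarrow> 'e \<Rightarrow> int" where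
  "toggle cov l X G = (\<lambda>e. if e \<in> X
     then Min (insert l (G ` {f. cov e f})) + Max (insert 0 (G ` {f. cov f e})) - G e else G e)"

definition linked :: "('e \<Rightarrow> 'e \<Rightarrow> bool) \<Rightarrow> 'e \<Rightarrow> 'e \<Rightarrow> bool" where
  "linked cov e f \<longleftrightarrow> cov e f \<or> cov f e"

text \<open>The value 0 off \<open>E\<close> represents each map on \<open>E\<close> exactly once,
  so that bijections with sets of labelings make sense.\<close>

definition bounded_maps :: "('e \<Rightarrow> 'e \<Rightarrow> bool) \<Rightarrow> int \<Rightarrow> 'e set \<Rightarrow> ('e \<Rightarrow> int) set" where
  "bounded_maps cov l E = {G. (\<forall>e\<in>E. 0 \<le> G e \<and> G e \<le> l) \<and> (\<forall>e. e \<notin> E \<longrightarrow> G e = 0) \<and>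
     (\<forall>e f. cov e f \<longrightarrow> G e \<le> G f)}"

lemma linked_sym: "linked cov e f \<longleftrightarrow> linked cov f e"
  by (auto simp: linked_def)

text \<open>The toggle at \<open>X\<close> reads only \<open>X\<close> and its neighbours, and the
  toggle at \<open>Y\<close> changes none of these values.\<close>

lemma toggle_toggle:
  assumes "X \<inter> Y = {}" and "\<And>e f. e \<in> X \<Longrightarrow> f \<in> Y \<Longrightarrow> \<not> linked cov e f"
  shows "toggle cov l X (toggle cov l Y G) = toggle cov l (X \<union> Y) G"
proof
  fix e
  show "toggle cov l X (toggle cov l Y G) e = toggle cov l (X \<union> Y) G e"
  proof (cases "e \<in> X")
    case True
    have 1: "toggle cov l Y G ` {f. cov e f} = G ` {f. cov e f}"
      using assms(2)[OF True] by (intro image_cong) (auto simp: toggle_def linked_def)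
    have 2: "toggle cov l Y G ` {f. cov f e} = G ` {f. cov f e}"
      using assms(2)[OF True] by (intro image_cong) (auto simp: toggle_def linked_def)
    have 3: "toggle cov l Y G e = G e"
      using assms(1) True by (auto simp: toggle_def)
    have "toggle cov l X (toggle cov l Y G) e =
        Min (insert l (toggle cov l Y G ` {f. cov e f})) +
        Max (insert 0 (toggle cov l Y G ` {f. cov f e})) - toggle cov l Y G e"
      using True by (subst toggle_def) simp
    also have "\<dots> = toggle cov l (X \<union> Y) G e"
      using True unfolding 1 2 3 by (simp add: toggle_def)
    finally show ?thesis .
  next
    case False
    then have "toggle cov l X (toggle cov l Y G) e = toggle cov l Y G e"
      by (subst toggle_def) simp
    then show ?thesis using False by (simp add: toggle_def)
  qed
qed

lemma toggle_singleton_commute: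
  assumes "\<not> linked cov e f"
  shows "toggle cov l {e} (toggle cov l {f} G) = toggle cov l {f} (toggle cov l {e} G)"
proof (cases "e = f")
  case False
  then show ?thesis
    using toggle_toggle[of "{e}" "{f}" cov l G] toggle_toggle[of "{f}" "{e}" cov l G] assms
    by (simp add: linked_sym insert_commute)
qed simp

text \<open>As \<open>e\<close> is not its own neighbour, both applications reflect in the same
  interval.\<close>

lemma toggle_involution:
  assumes "\<not> cov e e"
  shows "toggle cov l {e} (toggle cov l {e} G) = G"
proof
  fix g
  have 1: "toggle cov l {e} G ` {f. cov e f} = G ` {f. cov e f}"
    using assms by (intro image_cong) (auto simp: toggle_def)
  have 2: "toggle cov l {e} G ` {f. cov f e} = G ` {f. cov f e}"
    using assms by (intro image_cong) (auto simp: toggle_def)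
  have "toggle cov l {e} (toggle cov l {e} G) e =
      Min (insert l (toggle cov l {e} G ` {f. cov e f})) +
      Max (insert 0 (toggle cov l {e} G ` {f. cov f e})) - toggle cov l {e} G e"
    by (subst toggle_def) simp
  also have "\<dots> = G e" unfolding 1 2 by (simp add: toggle_def)
  finally show "toggle cov l {e} (toggle cov l {e} G) g = G g"
    by (cases "g = e") (simp_all add: toggle_def)
qed

lemma fold_toggle:
  assumes "distinct xs" and "\<And>e f. e \<in> set xs \<Longrightarrow> f \<in> set xs \<Longrightarrow> \<not> linked cov e f"
  shows "fold (\<lambda>e. toggle cov l {e}) xs G = toggle cov l (set xs) G"
  using assms
proof (induction xs arbitrary: G)
  case Nil
  then show ?case by (simp add: toggle_def)
next
  case (Cons x xs)
  have "fold (\<lambda>e. toggle cov l {e}) xs (toggle cov l {x} G) =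
      toggle cov l (set xs) (toggle cov l {x} G)"
    using Cons by simp
  also have "\<dots> = toggle cov l (set xs \<union> {x}) G"
    by (rule toggle_toggle) (use Cons.prems in auto)
  finally show ?case by simp
qed

section \<open>Toggles acting on bounded order-preserving maps\<close>

lemma bounded_maps_extrema:
  assumes "finite E" and "\<And>e f. cov e f \<Longrightarrow> e \<in> E \<and> f \<in> E"
    and "G \<in> bounded_maps cov l E" and "e \<in> E"
  shows "0 \<le> Max (insert 0 (G ` {f. cov f e}))" "Max (insert 0 (G ` {f. cov f e})) \<le> G e"
    and "G e \<le> Min (insert l (G ` {f. cov e f}))" "Min (insert l (G ` {f. cov e f})) \<le> l"
proof -
  have "finite {f. cov f e}" "finite {f. cov e f}"
    using assms(1,2) by (auto intro: finite_subset[of _ E])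
  then show "0 \<le> Max (insert 0 (G ` {f. cov f e}))" "Max (insert 0 (G ` {f. cov f e})) \<le> G e"
    "G e \<le> Min (insert l (G ` {f. cov e f}))" "Min (insert l (G ` {f. cov e f})) \<le> l"
    using assms(3,4) by (auto simp: bounded_maps_def)
qed

text \<open>At most one end of a pair \<open>cov e f\<close> is toggled. If it is \<open>e\<close>,
  the new value is at most the minimum over the upper neighbours of \<open>e\<close>, hence at most
  \<open>G f\<close>; the other case is dual.\<close>

lemma toggle_bounded_maps:
  assumes fin: "finite E" and cov: "\<And>e f. cov e f \<Longrightarrow> e \<in> E \<and> f \<in> E"
    and G: "G \<in> bounded_maps cov l E" and X: "X \<subseteq> E"
    and indep: "\<And>e f. e \<in> X \<Longrightarrow> f \<in> X \<Longrightarrow> \<not> cov e f"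
  shows "toggle cov l X G \<in> bounded_maps cov l E"
proof -
  have ext: "0 \<le> Max (insert 0 (G ` {f. cov f e}))" "Max (insert 0 (G ` {f. cov f e})) \<le> G e"
    "G e \<le> Min (insert l (G ` {f. cov e f}))" "Min (insert l (G ` {f. cov e f})) \<le> l"
    if "e \<in> E" for e
    using bounded_maps_extrema[of E cov G l e] fin cov G that by auto
  have up: "Min (insert l (G ` {f. cov e f})) \<le> G f" if "cov e f" for e f
    using that fin cov by (intro Min_le) (auto intro: finite_subset[of _ E])
  have dn: "G e \<le> Max (insert 0 (G ` {g. cov g f}))" if "cov e f" for e f
    using that fin cov by (intro Max_ge) (auto intro: finite_subset[of _ E])
  have mono: "toggle cov l X G e \<le> toggle cov l X G f" if c: "cov e f" for e f
  proof -
    have "e \<in> E" "f \<in> E" using cov c by auto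
    moreover have "G e \<le> G f" using G c by (auto simp: bounded_maps_def)
    ultimately show ?thesis
      using indep[of e f] c ext[of e] ext[of f] up[OF c] dn[OF c]
      unfolding toggle_def by (cases "e \<in> X"; cases "f \<in> X") auto
  qed
  have "0 \<le> toggle cov l X G e \<and> toggle cov l X G e \<le> l" if "e \<in> E" for e
    using ext[OF that] by (auto simp: toggle_def)
  moreover have "toggle cov l X G e = 0" if "e \<notin> E" for e
    using G that X by (auto simp: toggle_def bounded_maps_def)
  ultimately show ?thesis using mono by (simp add: bounded_maps_def)
qed

lemma toggle_bij_betw:
  assumes "finite E" and "\<And>e f. cov e f \<Longrightarrow> e \<in> E \<and> f \<in> E" and "e \<in> E" and "\<not> cov e e"
  shows "bij_betw (toggle cov l {e}) (bounded_maps cov l E) (bounded_maps cov l E)"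
  by (rule bij_betw_byWitness[where f' = "toggle cov l {e}"])
    (use assms in \<open>auto simp: toggle_involution intro!: toggle_bounded_maps\<close>)

text \<open>
  Only the relative order of linked elements matters, since toggles at unlinked ones commute.
\<close>

abbreviation height_sorted :: "('e \<Rightarrow> 'e \<Rightarrow> bool) \<Rightarrow> ('e \<Rightarrow> int) \<Rightarrow> 'e list \<Rightarrow> bool" where
  "height_sorted cov \<phi> \<equiv> sorted_wrt (\<lambda>e f. linked cov e f \<longrightarrow> \<phi> e < \<phi> f)"

lemma fold_toggle_move_front:
  assumes "\<And>u. u \<in> set us \<Longrightarrow> \<not> linked cov u e"
  shows "fold (\<lambda>e. toggle cov l {e}) (us @ e # vs) G =
    fold (\<lambda>e. toggle cov l {e}) (e # us @ vs) G"
proof -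
  have "toggle cov l {e} \<circ> fold (\<lambda>e. toggle cov l {e}) us =
      fold (\<lambda>e. toggle cov l {e}) us \<circ> toggle cov l {e}"
    by (rule fold_commute)
      (use assms in \<open>auto simp: fun_eq_iff toggle_singleton_commute linked_sym\<close>)
  from fun_cong[OF this, of G] show ?thesis by simp
qed

text \<open>The head \<open>e\<close> of \<open>xs\<close> can be moved to the front of
  \<open>ys\<close>: an element before \<open>e\<close> in \<open>ys\<close> comes after it in
  \<open>xs\<close>, so if it were linked to \<open>e\<close> it would have to be both lower and
  higher.\<close>

lemma fold_toggle_height_sorted_unique:
  assumes "distinct xs" "distinct ys" "set xs = set ys"
    and "height_sorted cov \<phi> xs" "height_sorted cov \<phi> ys"
  shows "fold (\<lambda>e. toggle cov l {e}) xs G = fold (\<lambda>e. toggle cov l {e}) ys G"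
  using assms
proof (induction xs arbitrary: ys G)
  case Nil
  then show ?case by simp
next
  case (Cons e xs)
  then obtain us vs where ys: "ys = us @ e # vs" by (metis list.set_intros(1) split_list)
  have "\<not> linked cov u e" if "u \<in> set us" for u
  proof -
    have "u \<in> set xs" using that Cons.prems(2,3) ys by auto
    then show ?thesis
      using that Cons.prems(4,5) ys by (fastforce simp: sorted_wrt_append linked_sym)
  qed
  then have "fold (\<lambda>e. toggle cov l {e}) ys G =
      fold (\<lambda>e. toggle cov l {e}) (us @ vs) (toggle cov l {e} G)"
    unfolding ys by (subst fold_toggle_move_front) auto
  also have "\<dots> = fold (\<lambda>e. toggle cov l {e}) xs (toggle cov l {e} G)"
    by (rule Cons.IH[symmetric]) (use Cons.prems ys in \<open>auto simp: sorted_wrt_append\<close>)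
  finally show ?case by simp
qed

text \<open>
  Induction on the total gap between the heights \<open>\<phi>\<close> and \<open>\<psi>\<close>: among the elements with
  \<open>\<phi> e < \<psi> e\<close> one of least height is a local minimum of \<open>\<phi>\<close>, so it can be raised by two.
\<close>

lemma toggle_products_conjugate:
  assumes fin: "finite E" and cov: "\<And>e f. cov e f \<Longrightarrow> e \<in> E \<and> f \<in> E"
    and \<phi>: "\<And>e f. cov e f \<Longrightarrow> \<bar>\<phi> e - \<phi> f\<bar> = 1" and \<psi>: "\<And>e f. cov e f \<Longrightarrow> \<bar>\<psi> e - \<psi> f\<bar> = 1"
    and le: "\<And>e. e \<in> E \<Longrightarrow> \<phi> e \<le> \<psi> e" and even: "\<And>e. e \<in> E \<Longrightarrow> even (\<psi> e - \<phi> e)"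
    and xs: "distinct xs" "set xs = E" "height_sorted cov \<phi> xs"
    and ys: "distinct ys" "set ys = E" "height_sorted cov \<psi> ys"
  shows "\<exists>\<Theta>. bij_betw \<Theta> (bounded_maps cov l E) (bounded_maps cov l E) \<and>
    (\<forall>G\<in>bounded_maps cov l E. \<Theta> (fold (\<lambda>e. toggle cov l {e}) xs G) =
       fold (\<lambda>e. toggle cov l {e}) ys (\<Theta> G))"
  using \<phi> le even xs
proof (induction "nat (\<Sum>e\<in>E. \<psi> e - \<phi> e)" arbitrary: \<phi> xs rule: less_induct)
  case less
  note \<phi> = less.prems(1) and le = less.prems(2) and even = less.prems(3) and xs = less.prems(4-6)
  show ?case
  proof (cases "\<forall>e\<in>E. \<phi> e = \<psi> e")
    case True
    have "height_sorted cov \<psi> xs"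
      using xs(3) by (rule sorted_wrt_mono_rel[rotated]) (use True xs(2) in auto)
    then show ?thesis
      using fold_toggle_height_sorted_unique[of xs ys cov \<psi>] xs ys
      by (intro exI[of _ id]) auto
  next
    case False
    let ?D = "{e \<in> E. \<phi> e < \<psi> e}"
    have "finite ?D" "?D \<noteq> {}" using fin False le by (auto simp: order.strict_iff_order)
    then obtain e where e: "e \<in> ?D" and min: "\<And>f. f \<in> ?D \<Longrightarrow> \<phi> e \<le> \<phi> f"
      using ex_is_arg_min_if_finite[of ?D \<phi>] by (auto simp: is_arg_min_linorder)
    \<comment> \<open>A neighbour \<open>f\<close> of height \<open>\<phi> e - 1\<close> would lie
      outside \<open>?D\<close> by the choice of \<open>e\<close>, so
      \<open>\<psi> f = \<phi> e - 1\<close>. Then \<open>\<psi> e\<close> is at most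
      \<open>\<phi> e\<close>, contrary to \<open>e\<close> being in \<open>?D\<close>.\<close>
    have local_min: "\<phi> f = \<phi> e + 1" if "linked cov e f" for f
    proof (rule ccontr)
      assume neq: "\<phi> f \<noteq> \<phi> e + 1"
      have f: "f \<in> E" using that cov by (auto simp: linked_def)
      have "\<bar>\<phi> e - \<phi> f\<bar> = 1" using that \<phi>[of e f] \<phi>[of f e] by (auto simp: linked_def)
      with neq have lt: "\<phi> f = \<phi> e - 1" by linarith
      with min[of f] f le[of f] have "\<phi> f = \<psi> f" by force
      moreover have "\<bar>\<psi> e - \<psi> f\<bar> = 1" using that \<psi>[of e f] \<psi>[of f e] by (auto simp: linked_def)
      ultimately show False using lt e by auto
    qed
    have local_min': "\<phi> f = \<phi> e + 1" if "linked cov f e" for f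
      using that local_min[of f] by (simp add: linked_sym)
    obtain us vs where split: "xs = us @ e # vs"
      using e xs(2) by (metis (mono_tags, lifting) mem_Collect_eq split_list)
    have us: "\<not> linked cov u e" if "u \<in> set us" for u
      using that xs(3) local_min'[of u] by (auto simp: split sorted_wrt_append)
    \<comment> \<open>All neighbours of \<open>e\<close> sit at \<open>\<phi> e + 1\<close>, so
      raising \<open>e\<close> by two keeps every height difference at one and turns
      \<open>e\<close> into a local maximum, which may be toggled last.\<close>
    define \<phi>' where "\<phi>' = \<phi>(e := \<phi> e + 2)"
    define xs' where "xs' = us @ vs @ [e]"
    have irr: "\<not> cov e e" using \<phi>[of e e] by auto
    \<comment> \<open>Parity turns the strict inequality into a gap of two, so the raised height
      still does not exceed \<open>\<psi>\<close>.\<close>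
    have gap: "\<phi> e + 2 \<le> \<psi> e"
      proof -
      have "even (\<psi> e - \<phi> e)" "0 < \<psi> e - \<phi> e" using e even[of e] by auto
      then have "2 \<le> \<psi> e - \<phi> e" by (intro zdvd_imp_le)
      then show ?thesis by simp
    qed
    have prems: "\<And>f g. cov f g \<Longrightarrow> \<bar>\<phi>' f - \<phi>' g\<bar> = 1" "\<And>f. f \<in> E \<Longrightarrow> \<phi>' f \<le> \<psi> f"
      "\<And>f. f \<in> E \<Longrightarrow> even (\<psi> f - \<phi>' f)"
      using \<phi> local_min irr le even gap by (auto simp: \<phi>'_def linked_def)
    have e': "e \<notin> set us" "e \<notin> set vs" using xs(1) split by auto
    have "height_sorted cov \<phi> (us @ vs)" using xs(3) by (auto simp: split sorted_wrt_append)
    then have "height_sorted cov \<phi>' (us @ vs)"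
      by (rule sorted_wrt_mono_rel[rotated]) (use e' in \<open>auto simp: \<phi>'_def\<close>)
    moreover have "\<phi>' z < \<phi>' e" if "z \<in> set (us @ vs)" "linked cov z e" for z
      using local_min'[OF that(2)] that(1) e' by (auto simp: \<phi>'_def)
    ultimately have sorted: "height_sorted cov \<phi>' xs'"
      using sorted_wrt_append[of "\<lambda>e f. linked cov e f \<longrightarrow> \<phi>' e < \<phi>' f" "us @ vs" "[e]"]
      by (simp add: xs'_def)
    have "(\<Sum>f\<in>E. \<psi> f - \<phi>' f) < (\<Sum>f\<in>E. \<psi> f - \<phi> f)"
      using e fin by (intro sum_strict_mono_ex1) (auto simp: \<phi>'_def)
    moreover have "0 \<le> (\<Sum>f\<in>E. \<psi> f - \<phi>' f)" using prems(2) by (intro sum_nonneg) auto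
    ultimately have dec: "nat (\<Sum>f\<in>E. \<psi> f - \<phi>' f) < nat (\<Sum>f\<in>E. \<psi> f - \<phi> f)" by linarith
    have "distinct xs'" "set xs' = E" using xs split by (auto simp: xs'_def)
    from less.hyps[OF dec prems this sorted] obtain \<Theta> where
      \<Theta>: "bij_betw \<Theta> (bounded_maps cov l E) (bounded_maps cov l E)" and
      eq: "\<And>G. G \<in> bounded_maps cov l E \<Longrightarrow> \<Theta> (fold (\<lambda>e. toggle cov l {e}) xs' G) =
        fold (\<lambda>e. toggle cov l {e}) ys (\<Theta> G)"
      by blast
    have bij: "bij_betw (toggle cov l {e}) (bounded_maps cov l E) (bounded_maps cov l E)"
      using e irr fin cov by (intro toggle_bij_betw) auto
    show ?thesis
    \<comment> \<open>The product over \<open>xs\<close> may start with \<open>e\<close>, the one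
      over \<open>xs'\<close> ends with \<open>e\<close>, and otherwise they agree. Hence the toggle
      at \<open>e\<close> intertwines them, and \<open>\<Theta>\<close> leads on to
      \<open>ys\<close>.\<close>
    proof (intro exI[of _ "\<Theta> \<circ> toggle cov l {e}"] conjI ballI)
      show "bij_betw (\<Theta> \<circ> toggle cov l {e}) (bounded_maps cov l E) (bounded_maps cov l E)"
        by (rule bij_betw_trans[OF bij \<Theta>])
      fix G assume G: "G \<in> bounded_maps cov l E"
      have "toggle cov l {e} (fold (\<lambda>e. toggle cov l {e}) xs G) =
          fold (\<lambda>e. toggle cov l {e}) xs' (toggle cov l {e} G)"
        unfolding split xs'_def by (subst fold_toggle_move_front[OF us]) auto
      then show "(\<Theta> \<circ> toggle cov l {e}) (fold (\<lambda>e. toggle cov l {e}) xs G) =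
          fold (\<lambda>e. toggle cov l {e}) ys ((\<Theta> \<circ> toggle cov l {e}) G)"
        using eq[OF bij_betw_apply[OF bij G]] by simp
    qed
  qed
qed

section \<open>Labelings with interval restrictions\<close>

text \<open>Such a set is the interval from its minimum to \<open>l\<close>. This serves both for
  the positions in a fiber and for the indices \<open>j\<close> of levels.\<close>

lemma up_closed_mem_iff:
  fixes A :: "nat set" and l t :: nat
  assumes "A \<subseteq> {1..l}" and up: "\<And>s t. s \<in> A \<Longrightarrow> s \<le> t \<Longrightarrow> t \<le> l \<Longrightarrow> t \<in> A" and t: "t \<in> {1..l}"
  shows "t \<in> A \<longleftrightarrow> int t > int l - int (card A)"
proof (cases "A = {}")
  case True
  then show ?thesis using t by auto
next
  case False
  have fin: "finite A" using assms(1) by (rule finite_subset) simp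
  have "Min A \<in> A" using fin False by simp
  then have A: "A = {Min A..l}" and "Min A \<le> l"
    using assms(1) up[of "Min A"] Min_le[OF fin] by auto
  then have "card A = l + 1 - Min A" by (metis card_atLeastAtMost Suc_eq_plus1)
  moreover have "t \<in> A \<longleftrightarrow> Min A \<le> t" by (subst A) (use t in auto)
  ultimately show ?thesis using t \<open>Min A \<le> l\<close> by auto
qed

text \<open>What the two sides of the theorem have in common. It is interpreted for
  \<open>P \<times> {1..a}\<close> with parameter \<open>b\<close> and for
  \<open>P \<times> {1..b}\<close> with parameter \<open>a\<close>.\<close>

locale graded_labelings =
  fixes Q :: "'q::order set" and r :: "'q \<Rightarrow> int" and R :: "'q \<Rightarrow> int set" and b l :: nat
  assumes finite_Q: "finite Q"
    and r_mono: "x \<in> Q \<Longrightarrow> y \<in> Q \<Longrightarrow> x < y \<Longrightarrow> r x < r y"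
    and r_step: "x \<in> Q \<Longrightarrow> y \<in> Q \<Longrightarrow> x < y \<Longrightarrow> \<exists>z\<in>Q. x < z \<and> z \<le> y \<and> r z = r x + 1"
    and R_eq: "x \<in> Q \<Longrightarrow> R x = {r x + 1..r x + 1 + int b}"
begin

abbreviation "L \<equiv> strict_labelings Q l R"

definition E :: "('q \<times> nat) set" where "E = Q \<times> {1..b}"

text \<open>The position \<open>(x, j)\<close> stands for the boundary between the labels \<open>lev (x, j)\<close> and
  \<open>lev (x, j) + 1\<close> in the fiber over \<open>x\<close>.\<close>

definition lev :: "'q \<times> nat \<Rightarrow> int" where "lev = (\<lambda>(x, j). r x + 1 + int b - int j)"

text \<open>By \<open>r_mono\<close> and \<open>r_step\<close> the pairs \<open>x < y\<close> with
  ranks differing by one are exactly the covers of \<open>Q\<close>, so this is the cover relation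
  of \<open>Q \<times> {1..b}\<close>.\<close>

definition cov :: "'q \<times> nat \<Rightarrow> 'q \<times> nat \<Rightarrow> bool" where
  "cov = (\<lambda>(x, j) (y, j'). x \<in> Q \<and> y \<in> Q \<and> j \<in> {1..b} \<and> j' \<in> {1..b} \<and>
     (x < y \<and> r y = r x + 1 \<and> j' = j \<or> y = x \<and> j' = j + 1))"

abbreviation "S \<equiv> bounded_maps cov (int l) E"

definition counts :: "('q \<times> nat \<Rightarrow> int) \<Rightarrow> 'q \<times> nat \<Rightarrow> int" where
  "counts f = (\<lambda>(x, j). if (x, j) \<in> E
     then int (card {t \<in> {1..l}. f (x, t) > lev (x, j)}) else 0)"

text \<open>Fibers are weakly increasing, so the labels above a given level occupy the last positions.\<close>

definition corresponds :: "('q \<times> nat \<Rightarrow> int) \<Rightarrow> ('q \<times> nat \<Rightarrow> int) \<Rightarrow> bool" where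
  "corresponds f G \<longleftrightarrow> (\<forall>x\<in>Q. \<forall>t\<in>{1..l}. f (x, t) \<in> R x \<and>
     (\<forall>j\<in>{1..b}. f (x, t) > lev (x, j) \<longleftrightarrow> int t > int l - G (x, j)))"

lemma finite_E: "finite E"
  using finite_Q by (simp add: E_def)

lemma cov_E: "cov e f \<Longrightarrow> e \<in> E \<and> f \<in> E"
  by (auto simp: cov_def E_def)

lemma cov_lev: "cov e f \<Longrightarrow> \<bar>lev e - lev f\<bar> = 1"
  by (auto simp: cov_def lev_def)

lemma linked_lev: "linked cov e f \<Longrightarrow> lev e \<noteq> lev f"
  using cov_lev[of e f] cov_lev[of f e] by (auto simp: linked_def)

section \<open>Labelings correspond to bounded order-preserving maps\<close>

lemma labelingD:
  assumes "f \<in> L"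
  shows "x \<in> Q \<Longrightarrow> y \<in> Q \<Longrightarrow> t \<in> {1..l} \<Longrightarrow> x < y \<Longrightarrow> f (x, t) < f (y, t)"
    and "x \<in> Q \<Longrightarrow> t \<in> {1..l} \<Longrightarrow> t' \<in> {1..l} \<Longrightarrow> t \<le> t' \<Longrightarrow> f (x, t) \<le> f (x, t')"
    and "x \<in> Q \<Longrightarrow> t \<in> {1..l} \<Longrightarrow> r x + 1 \<le> f (x, t) \<and> f (x, t) \<le> r x + 1 + int b"
    and "f \<in> extensional (Q \<times> {1..l})"
  using assms by (force simp: strict_labelings_def R_eq)+

lemma corresponds_counts:
  assumes f: "f \<in> L"
  shows "corresponds f (counts f)"
  unfolding corresponds_def
proof (intro ballI conjI)
  fix x t assume x: "x \<in> Q" and t: "t \<in> {1..l}"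
  show "f (x, t) \<in> R x" using labelingD(3)[OF f x t] R_eq[OF x] by auto
  fix j assume j: "j \<in> {1..b}"
  have "t \<in> {t \<in> {1..l}. lev (x, j) < f (x, t)} \<longleftrightarrow>
      int t > int l - int (card {t \<in> {1..l}. lev (x, j) < f (x, t)})"
    by (rule up_closed_mem_iff) (use labelingD(2)[OF f x] t in \<open>auto intro: less_le_trans\<close>)
  then show "lev (x, j) < f (x, t) \<longleftrightarrow> int l - counts f (x, j) < int t"
    using x t j by (simp add: counts_def E_def)
qed

lemma above_iff_counts:
  assumes "f \<in> L" "x \<in> Q" "t \<in> {1..l}" "j \<in> {1..b}"
  shows "f (x, t) > lev (x, j) \<longleftrightarrow> int t > int l - counts f (x, j)"
  using corresponds_counts[OF assms(1)] assms(2-) by (auto simp: corresponds_def)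

text \<open>Along a cover in \<open>Q\<close> the level rises by one, which strictness of the
  labeling makes up for; from \<open>j\<close> to \<open>j + 1\<close> the level drops and the count
  can only grow.\<close>

lemma counts_in:
  assumes f: "f \<in> L"
  shows "counts f \<in> S"
  unfolding bounded_maps_def
proof (intro CollectI conjI allI impI ballI)
  fix e assume "e \<in> E"
  have "card {t \<in> {1..l}. f (fst e, t) > lev e} \<le> card {1..l}" by (intro card_mono) auto
  then show "counts f e \<le> int l" "0 \<le> counts f e" by (auto simp: counts_def split: prod.splits)
next
  fix e assume "e \<notin> E"
  then show "counts f e = 0" by (auto simp: counts_def split: prod.splits)
next
  fix e g assume c: "cov e g"
  obtain x j y j' where e: "e = (x, j)" "g = (y, j')" by (metis surj_pair)
  have "{t \<in> {1..l}. f (x, t) > lev (x, j)} \<subseteq> {t \<in> {1..l}. f (y, t) > lev (y, j')}"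
    using c labelingD(1)[OF f, of x y] by (fastforce simp: e cov_def lev_def)
  then have "card {t \<in> {1..l}. f (x, t) > lev (x, j)} \<le> card {t \<in> {1..l}. f (y, t) > lev (y, j')}"
    by (intro card_mono) auto
  then show "counts f e \<le> counts f g" using cov_E[OF c] by (simp add: counts_def e)
qed

lemma lev_surj:
  assumes "r x < k" "k \<le> r x + int b"
  obtains j where "j \<in> {1..b}" "lev (x, j) = k"
  by (rule that[of "nat (r x + 1 + int b - k)"]) (use assms in \<open>auto simp: lev_def\<close>)

text \<open>For a label above the least allowed one, take the level just below it. Monotonicity of
  \<open>G\<close> along a cover \<open>x < y\<close> carries "exceeds this level" from
  \<open>x\<close> to \<open>y\<close>, where the level is one higher; this is strictness. General
  pairs follow by climbing covers.\<close>

lemma corresponds_imp_labeling: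
  assumes ext: "f \<in> extensional (Q \<times> {1..l})" and G: "G \<in> S" and c: "corresponds f G"
  shows "f \<in> L"
proof -
  have rng: "r x + 1 \<le> f (x, t) \<and> f (x, t) \<le> r x + 1 + int b" if "x \<in> Q" "t \<in> {1..l}" for x t
    using c that by (auto simp: corresponds_def R_eq)
  have above: "f (x, t) > lev (x, j) \<longleftrightarrow> int t > int l - G (x, j)"
    if "x \<in> Q" "t \<in> {1..l}" "j \<in> {1..b}" for x t j
    using c that by (auto simp: corresponds_def)
  have cover: "f (x, t) < f (y, t)"
    if x: "x \<in> Q" and y: "y \<in> Q" and t: "t \<in> {1..l}" and xy: "x < y" "r y = r x + 1" for x y t
  proof (cases "f (x, t) = r x + 1")
    case True
    then show ?thesis using rng[OF y t] xy by simp
  next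
    case False
    then have "r x < f (x, t) - 1" "f (x, t) - 1 \<le> r x + int b" using rng[OF x t] by auto
    then obtain j where j: "j \<in> {1..b}" "lev (x, j) = f (x, t) - 1" by (rule lev_surj)
    have "cov (x, j) (y, j)" using x y xy j by (simp add: cov_def)
    then have "G (x, j) \<le> G (y, j)" using G by (auto simp: bounded_maps_def)
    moreover have "int t > int l - G (x, j)" using above[OF x t j(1)] j(2) by simp
    ultimately have "f (y, t) > lev (y, j)" using above[OF y t j(1)] by simp
    then show ?thesis using j(2) xy by (simp add: lev_def)
  qed
  have strict: "f (x, t) < f (y, t)"
    if "x \<in> Q" "y \<in> Q" "t \<in> {1..l}" "x < y" for x y t
    using that
  proof (induction "nat (r y - r x)" arbitrary: x rule: less_induct)
    case less
    obtain z where z: "z \<in> Q" "x < z" "z \<le> y" "r z = r x + 1" using r_step less.prems by blast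
    have "f (x, t) < f (z, t)" using cover less.prems z by auto
    moreover have "f (z, t) \<le> f (y, t)"
    proof (cases "z = y")
      case False
      then have zy: "z < y" using z by simp
      then have "nat (r y - r z) < nat (r y - r x)" using r_mono[OF z(1) less.prems(2)] z by linarith
      then show ?thesis using less.hyps[of z] less.prems z zy by auto
    qed simp
    ultimately show ?case by simp
  qed
  have mono: "f (x, t) \<le> f (x, t')"
    if x: "x \<in> Q" and t: "t \<in> {1..l}" "t' \<in> {1..l}" "t \<le> t'" for x t t'
  proof (cases "f (x, t) = r x + 1")
    case True
    then show ?thesis using rng[OF x t(2)] by simp
  next
    case False
    then have "r x < f (x, t) - 1" "f (x, t) - 1 \<le> r x + int b" using rng[OF x t(1)] by auto
    then obtain j where j: "j \<in> {1..b}" "lev (x, j) = f (x, t) - 1" by (rule lev_surj)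
    then show ?thesis using above[OF x t(1) j(1)] above[OF x t(2) j(1)] t by simp
  qed
  show ?thesis
    using ext strict mono c by (simp add: strict_labelings_def corresponds_def)
qed

lemma corresponds_imp_counts:
  assumes G: "G \<in> S" and c: "corresponds f G"
  shows "counts f = G"
proof
  fix e :: "'q \<times> nat"
  obtain x j where e: "e = (x, j)" by (metis surj_pair)
  show "counts f e = G e"
  proof (cases "e \<in> E")
    case True
    then have xj: "x \<in> Q" "j \<in> {1..b}" by (auto simp: E_def e)
    have G_rng: "0 \<le> G e" "G e \<le> int l" using G True by (auto simp: bounded_maps_def)
    have "{t \<in> {1..l}. f (x, t) > lev (x, j)} = {t \<in> {1..l}. int t > int l - G e}"
      using c xj by (auto simp: corresponds_def e)
    also have "\<dots> = {l - nat (G e) + 1..l}" using G_rng by auto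
    finally show ?thesis using True G_rng by (simp add: counts_def e)
  next
    case False
    then show ?thesis using G by (auto simp: counts_def e bounded_maps_def)
  qed
qed

text \<open>Two distinct labels in the same fiber are separated by the level equal to the smaller of
  them.\<close>

lemma corresponds_unique:
  assumes "f \<in> extensional (Q \<times> {1..l})" "g \<in> extensional (Q \<times> {1..l})"
    and "corresponds f G" "corresponds g G"
  shows "f = g"
proof (rule extensionalityI[OF assms(1,2)], clarify)
  fix x t assume x: "x \<in> Q" and t: "t \<in> {1..l}"
  have rng: "r x + 1 \<le> f (x, t)" "f (x, t) \<le> r x + 1 + int b"
      "r x + 1 \<le> g (x, t)" "g (x, t) \<le> r x + 1 + int b"
    using assms(3,4) x t by (auto simp: corresponds_def R_eq)
  have same: "f (x, t) > lev (x, j) \<longleftrightarrow> g (x, t) > lev (x, j)" if "j \<in> {1..b}" for j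
    using assms(3,4) x t that by (auto simp: corresponds_def)
  show "f (x, t) = g (x, t)"
  proof (rule ccontr)
    assume "f (x, t) \<noteq> g (x, t)"
    then have "r x < min (f (x, t)) (g (x, t))" "min (f (x, t)) (g (x, t)) \<le> r x + int b"
      using rng by auto
    then obtain j where "j \<in> {1..b}" "lev (x, j) = min (f (x, t)) (g (x, t))" by (rule lev_surj)
    then show False using same[of j] \<open>f (x, t) \<noteq> g (x, t)\<close> by auto
  qed
qed

lemma corresponds_exists:
  assumes G: "G \<in> S"
  shows "\<exists>f\<in>extensional (Q \<times> {1..l}). corresponds f G"
proof -
  \<comment> \<open>The indices of the levels that the label at \<open>(x, t)\<close> has to exceed.
    They are up-closed in \<open>{1..b}\<close> because \<open>G\<close> increases with
    \<open>j\<close>, so their number determines the label.\<close>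
  define A where "A x t = {j \<in> {1..b}. int t > int l - G (x, j)}" for x t
  define f where "f = restrict (\<lambda>(x, t). r x + 1 + int (card (A x t))) (Q \<times> {1..l})"
  have "corresponds f G"
    unfolding corresponds_def
  proof (intro ballI conjI)
    fix x t assume x: "x \<in> Q" and t: "t \<in> {1..l}"
    have fx: "f (x, t) = r x + 1 + int (card (A x t))" using x t by (simp add: f_def)
    have "card (A x t) \<le> card {1..b}" by (intro card_mono) (auto simp: A_def)
    then show "f (x, t) \<in> R x" using x by (simp add: fx R_eq)
    fix j assume j: "j \<in> {1..b}"
    have step: "G (x, i) \<le> G (x, i + 1)" if "1 \<le> i" "i + 1 \<le> b" for i
    proof -
      have "cov (x, i) (x, i + 1)" using x that by (simp add: cov_def)
      then show ?thesis using G by (auto simp: bounded_maps_def)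
    qed
    have mono: "G (x, i) \<le> G (x, i')" if "1 \<le> i" "i \<le> i'" "i' \<le> b" for i i'
      using that(2,3)
    proof (induction rule: dec_induct)
      case (step k)
      then show ?case using \<open>1 \<le> i\<close> \<open>\<And>i. 1 \<le> i \<Longrightarrow> i + 1 \<le> b \<Longrightarrow> G (x, i) \<le> G (x, i + 1)\<close>[of k] by auto
    qed simp
    have "j \<in> A x t \<longleftrightarrow> int j > int b - int (card (A x t))"
    proof (rule up_closed_mem_iff)
      show "A x t \<subseteq> {1..b}" by (auto simp: A_def)
      show "i' \<in> A x t" if "i \<in> A x t" "i \<le> i'" "i' \<le> b" for i i'
        using mono[of i i'] that by (auto simp: A_def)
    qed (rule j)
    then show "lev (x, j) < f (x, t) \<longleftrightarrow> int l - G (x, j) < int t"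
      using j by (auto simp: fx lev_def A_def)
  qed
  moreover have "f \<in> extensional (Q \<times> {1..l})" by (simp add: f_def)
  ultimately show ?thesis by blast
qed

lemma counts_bij: "bij_betw counts L S"
proof (rule bij_betw_imageI)
  show "inj_on counts L"
  proof (rule inj_onI)
    fix f g assume fg: "f \<in> L" "g \<in> L" "counts f = counts g"
    then have "corresponds f (counts f)" "corresponds g (counts f)"
      using corresponds_counts by metis+
    then show "f = g" by (rule corresponds_unique[OF labelingD(4)[OF fg(1)] labelingD(4)[OF fg(2)]])
  qed
  show "counts ` L = S"
  proof
    show "counts ` L \<subseteq> S" using counts_in by auto
    show "S \<subseteq> counts ` L"
    proof
      fix G assume G: "G \<in> S"
      obtain f where f: "f \<in> extensional (Q \<times> {1..l})" "corresponds f G"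
        using corresponds_exists[OF G] by blast
      show "G \<in> counts ` L"
        using imageI[where f = counts, OF corresponds_imp_labeling[OF f(1) G f(2)]]
        by (simp add: corresponds_imp_counts[OF G f(2)])
    qed
  qed
qed

section \<open>Raisable and lowerable labels in terms of covers\<close>

lemma raisable_iff:
  assumes f: "f \<in> L" and x: "x \<in> Q" and t: "t \<in> {1..l}" and k: "f (x, t) = k" "k \<le> r x + int b"
  shows "raisable Q l R f x t \<longleftrightarrow> (\<forall>y\<in>Q. x < y \<and> r y = r x + 1 \<longrightarrow> f (y, t) > k + 1)"
proof
  assume "raisable Q l R f x t"
  then obtain g where g: "g \<in> L" "f (x, t) < g (x, t)"
    "\<And>y s. y \<in> Q \<Longrightarrow> s \<in> {1..l} \<Longrightarrow> y \<noteq> x \<Longrightarrow> f (y, s) = g (y, s)"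
    unfolding raisable_def by blast
  have "f (y, t) > k + 1" if "y \<in> Q" "x < y" for y
  proof -
    have "g (x, t) < g (y, t)" using labelingD(1)[OF g(1) x] that t by auto
    also have "g (y, t) = f (y, t)" using g(3)[of y t] that t by auto
    finally show ?thesis using g(2) k by simp
  qed
  then show "\<forall>y\<in>Q. x < y \<and> r y = r x + 1 \<longrightarrow> f (y, t) > k + 1" by auto
next
  assume up: "\<forall>y\<in>Q. x < y \<and> r y = r x + 1 \<longrightarrow> f (y, t) > k + 1"
  have up': "f (y, s) > k + 1" if y: "y \<in> Q" "x < y" and s: "s \<in> {1..l}" "t \<le> s" for y s
  proof -
    obtain z where z: "z \<in> Q" "x < z" "z \<le> y" "r z = r x + 1" using r_step[OF x y] by blast
    have "k + 1 < f (z, t)" using up z by auto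
    also have "f (z, t) \<le> f (y, t)"
      using labelingD(1)[OF f z(1) y(1) t] z(3) by (cases "z = y") (auto simp: less_le)
    also have "f (y, t) \<le> f (y, s)" using labelingD(2)[OF f y(1) t s] .
    finally show ?thesis .
  qed
  \<comment> \<open>Raising position \<open>t\<close> alone could break monotonicity of the fiber,
    so later labels are lifted to \<open>k + 1\<close> as well where necessary. By
    \<open>up'\<close> they stay below all fibers above \<open>x\<close>.\<close>
  define g where "g = (\<lambda>(y, s). if y = x \<and> s \<in> {t..l} then max (f (y, s)) (k + 1) else f (y, s))"
  have "g \<in> L"
    unfolding strict_labelings_def
  proof (intro CollectI conjI ballI impI)
    show "g \<in> extensional (Q \<times> {1..l})"
      using labelingD(4)[OF f] x t by (auto simp: g_def extensional_def)
    fix y s assume y: "y \<in> Q" and s: "s \<in> {1..l}"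
    show "g (y, s) \<in> R y"
      using labelingD(3)[OF f y s] labelingD(3)[OF f x t] k by (auto simp: g_def R_eq[OF y])
    show "g (y, s) \<le> g (y, s')" if "s' \<in> {1..l}" "s \<le> s'" for s'
      using labelingD(2)[OF f y s that] s that by (auto simp: g_def)
  next
    fix y z s assume *: "y \<in> Q" "z \<in> Q" "s \<in> {1..l}" "y < z"
    then show "g (y, s) < g (z, s)"
      using labelingD(1)[OF f *] up'[of z s] by (auto simp: g_def)
  qed
  then show "raisable Q l R f x t"
    unfolding raisable_def using t k by (intro bexI[of _ g]) (auto simp: g_def)
qed

lemma lowerable_iff:
  assumes f: "f \<in> L" and x: "x \<in> Q" and t: "t \<in> {1..l}" and k: "f (x, t) = k + 1" "r x + 1 \<le> k"
  shows "lowerable Q l R f x t \<longleftrightarrow> (\<forall>y\<in>Q. y < x \<and> r x = r y + 1 \<longrightarrow> f (y, t) < k)"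
proof
  assume "lowerable Q l R f x t"
  then obtain g where g: "g \<in> L" "f (x, t) > g (x, t)"
    "\<And>y s. y \<in> Q \<Longrightarrow> s \<in> {1..l} \<Longrightarrow> y \<noteq> x \<Longrightarrow> f (y, s) = g (y, s)"
    unfolding lowerable_def by blast
  have "f (y, t) < k" if "y \<in> Q" "y < x" for y
  proof -
    have "f (y, t) = g (y, t)" using g(3)[of y t] that t by auto
    also have "g (y, t) < g (x, t)" using labelingD(1)[OF g(1) _ x] that t by auto
    finally show ?thesis using g(2) k by simp
  qed
  then show "\<forall>y\<in>Q. y < x \<and> r x = r y + 1 \<longrightarrow> f (y, t) < k" by auto
next
  assume dn: "\<forall>y\<in>Q. y < x \<and> r x = r y + 1 \<longrightarrow> f (y, t) < k"
  have dn': "f (y, s) < k" if y: "y \<in> Q" "y < x" and s: "s \<in> {1..l}" "s \<le> t" for y s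
  proof -
    have "f (y, t) < k"
    proof -
      obtain z where z: "z \<in> Q" "y < z" "z \<le> x" "r z = r y + 1" using r_step[OF y(1) x y(2)] by blast
      show ?thesis
      proof (cases "z = x")
        case True
        then show ?thesis using dn y z by auto
      next
        case False
        then show ?thesis
          using labelingD(1)[OF f y(1) z(1) t z(2)] labelingD(1)[OF f z(1) x t] z(3) k by (auto simp: less_le)
      qed
    qed
    then show ?thesis using labelingD(2)[OF f y(1) s(1) t s(2)] by simp
  qed
  \<comment> \<open>Dually, the labels before position \<open>t\<close> are pushed down along with
    it.\<close>
  define g where "g = (\<lambda>(y, s). if y = x \<and> s \<in> {1..t} then min (f (y, s)) k else f (y, s))"
  have "g \<in> L"
    unfolding strict_labelings_def
  proof (intro CollectI conjI ballI impI)
    show "g \<in> extensional (Q \<times> {1..l})"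
      using labelingD(4)[OF f] x t by (auto simp: g_def extensional_def)
    fix y s assume y: "y \<in> Q" and s: "s \<in> {1..l}"
    show "g (y, s) \<in> R y"
      using labelingD(3)[OF f y s] labelingD(3)[OF f x t] k by (auto simp: g_def R_eq[OF y])
    show "g (y, s) \<le> g (y, s')" if "s' \<in> {1..l}" "s \<le> s'" for s'
      using labelingD(2)[OF f y s that] s that by (auto simp: g_def)
  next
    fix y z s assume *: "y \<in> Q" "z \<in> Q" "s \<in> {1..l}" "y < z"
    then show "g (y, s) < g (z, s)"
      using labelingD(1)[OF f *] dn'[of y s] by (auto simp: g_def)
  qed
  then show "lowerable Q l R f x t"
    unfolding lowerable_def using t k by (intro bexI[of _ g]) (auto simp: g_def)
qed

text \<open>The upper end of the toggle interval in terms of labels. For a label equal to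
  \<open>lev (x, j)\<close> the right-hand side is the criterion of
  \<open>raisable_iff\<close>.\<close>

lemma above_Min_iff:
  assumes f: "f \<in> L" and x: "x \<in> Q" and j: "j \<in> {1..b}" and t: "t \<in> {1..l}"
  shows "int t > int l - Min (insert (int l) (counts f ` {e. cov (x, j) e})) \<longleftrightarrow>
    (\<forall>y\<in>Q. x < y \<and> r y = r x + 1 \<longrightarrow> f (y, t) > lev (x, j) + 1) \<and> f (x, t) \<ge> lev (x, j)"
proof -
  have fin: "finite {e. cov (x, j) e}" using cov_E by (intro finite_subset[OF _ finite_E]) auto
  have "int t > int l - Min (insert (int l) (counts f ` {e. cov (x, j) e})) \<longleftrightarrow>
      (\<forall>e. cov (x, j) e \<longrightarrow> int t > int l - counts f e)"
    using fin t Min_gr_iff[of "insert (int l) (counts f ` {e. cov (x, j) e})" "int l - int t"]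
    by (auto simp: algebra_simps)
  also have "\<dots> \<longleftrightarrow> (\<forall>y\<in>Q. x < y \<and> r y = r x + 1 \<longrightarrow> int t > int l - counts f (y, j)) \<and>
      (j < b \<longrightarrow> int t > int l - counts f (x, j + 1))"
    using x j by (auto simp: cov_def)
  also have "\<dots> \<longleftrightarrow> (\<forall>y\<in>Q. x < y \<and> r y = r x + 1 \<longrightarrow> f (y, t) > lev (y, j)) \<and>
      (j < b \<longrightarrow> f (x, t) > lev (x, j + 1))"
    using above_iff_counts[OF f _ t] x j by auto
  also have "(\<forall>y\<in>Q. x < y \<and> r y = r x + 1 \<longrightarrow> f (y, t) > lev (y, j)) \<longleftrightarrow>
      (\<forall>y\<in>Q. x < y \<and> r y = r x + 1 \<longrightarrow> f (y, t) > lev (x, j) + 1)"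
    by (auto simp: lev_def)
  \<comment> \<open>For \<open>j = b\<close> the left side is vacuous, and the right side holds
    because \<open>lev (x, b)\<close> is the least allowed label.\<close>
  also have "(j < b \<longrightarrow> f (x, t) > lev (x, j + 1)) \<longleftrightarrow> f (x, t) \<ge> lev (x, j)"
    using labelingD(3)[OF f x t] j by (auto simp: lev_def)
  finally show ?thesis .
qed

text \<open>The lower end of the toggle interval. For a label equal to \<open>lev (x, j) + 1\<close>
  the negation of the right-hand side is the criterion of \<open>lowerable_iff\<close>.\<close>

lemma above_Max_iff:
  assumes f: "f \<in> L" and x: "x \<in> Q" and j: "j \<in> {1..b}" and t: "t \<in> {1..l}"
  shows "int t > int l - Max (insert 0 (counts f ` {e. cov e (x, j)})) \<longleftrightarrow>
    (\<exists>y\<in>Q. y < x \<and> r x = r y + 1 \<and> f (y, t) \<ge> lev (x, j)) \<or> f (x, t) > lev (x, j) + 1"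
proof -
  have fin: "finite {e. cov e (x, j)}" using cov_E by (intro finite_subset[OF _ finite_E]) auto
  have "int t > int l - Max (insert 0 (counts f ` {e. cov e (x, j)})) \<longleftrightarrow>
      (\<exists>e. cov e (x, j) \<and> int t > int l - counts f e)"
    using fin t Max_gr_iff[of "insert 0 (counts f ` {e. cov e (x, j)})" "int l - int t"]
    by (auto simp: algebra_simps)
  also have "\<dots> \<longleftrightarrow> (\<exists>y\<in>Q. y < x \<and> r x = r y + 1 \<and> int t > int l - counts f (y, j)) \<or>
      (1 < j \<and> int t > int l - counts f (x, j - 1))"
  proof -
    have "cov e (x, j) \<longleftrightarrow> (\<exists>y\<in>Q. y < x \<and> r x = r y + 1 \<and> e = (y, j)) \<or> (1 < j \<and> e = (x, j - 1))" for e
      using x j by (cases e) (auto simp: cov_def)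
    then show ?thesis by auto
  qed
  also have "\<dots> \<longleftrightarrow> (\<exists>y\<in>Q. y < x \<and> r x = r y + 1 \<and> f (y, t) > lev (y, j)) \<or>
      (1 < j \<and> f (x, t) > lev (x, j - 1))"
  proof -
    have "lev (x, j - 1) < f (x, t) \<longleftrightarrow> int l - counts f (x, j - 1) < int t" if "1 < j"
    proof (rule above_iff_counts[OF f x t])
      have "1 \<le> j - 1" "j - 1 \<le> b" using j that unfolding atLeastAtMost_iff by linarith+
      then show "j - 1 \<in> {1..b}" by simp
    qed
    then show ?thesis using above_iff_counts[OF f _ t j] by blast
  qed
  also have "(\<exists>y\<in>Q. y < x \<and> r x = r y + 1 \<and> f (y, t) > lev (y, j)) \<longleftrightarrow>
      (\<exists>y\<in>Q. y < x \<and> r x = r y + 1 \<and> f (y, t) \<ge> lev (x, j))"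
    by (auto simp: lev_def)
  \<comment> \<open>For \<open>j = 1\<close> both sides are false, since
    \<open>lev (x, 1) + 1\<close> is the largest allowed label.\<close>
  also have "(1 < j \<and> f (x, t) > lev (x, j - 1)) \<longleftrightarrow> f (x, t) > lev (x, j) + 1"
    using labelingD(3)[OF f x t] j by (auto simp: lev_def)
  finally show ?thesis .
qed

section \<open>Bender-Knuth involutions as toggles\<close>

lemma next_label_eq:
  assumes "x \<in> Q" "r x + 1 \<le> k" "k \<le> r x + int b"
  shows "next_label R x k = k + 1"
proof -
  have "{m \<in> R x. k < m} = {k + 1..r x + 1 + int b}"
    using assms by (auto simp: R_eq)
  moreover have "Min {k + 1..r x + 1 + int b} = k + 1"
    by (rule Min_eqI) (use assms in auto)
  ultimately show ?thesis by (simp add: next_label_def)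
qed

lemma bender_knuth_inactive:
  assumes "x \<in> Q" "\<not> (r x + 1 \<le> k \<and> k \<le> r x + int b)"
  shows "bender_knuth Q l R k f (x, t) = f (x, t)"
  using assms by (auto simp: bender_knuth_def free_low_def free_high_def R_eq)

text \<open>The free positions form the interval \<open>l - U < t \<le> l - D\<close>, in which the boundary between
  \<open>k\<close> and \<open>k + 1\<close> is reflected.\<close>

lemma bender_knuth_active:
  assumes f: "f \<in> L" and x: "x \<in> Q" and j: "j \<in> {1..b}" and t: "t \<in> {1..l}" and k: "k = lev (x, j)"
  defines "U \<equiv> Min (insert (int l) (counts f ` {e. cov (x, j) e}))"
    and "D \<equiv> Max (insert 0 (counts f ` {e. cov e (x, j)}))"
  shows "bender_knuth Q l R k f (x, t) =
    (if int l - U < int t \<and> int t \<le> int l - D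
     then if int t \<le> int l - (U + D - counts f (x, j)) then k else k + 1 else f (x, t))"
    and "int l - U < int t \<and> int t \<le> int l - D \<longrightarrow> f (x, t) = k \<or> f (x, t) = k + 1"
proof -
  have k_rng: "r x + 1 \<le> k" "k \<le> r x + int b" using j by (auto simp: k lev_def)
  have xjE: "(x, j) \<in> E" using x j by (simp add: E_def)
  have "0 \<le> D" "D \<le> counts f (x, j)" "counts f (x, j) \<le> U" "U \<le> int l"
    unfolding U_def D_def
    using bounded_maps_extrema[of E cov "counts f" "int l" "(x, j)"]
      finite_E cov_E counts_in[OF f] xjE by auto
  note order = this
  have G: "f (x, s) > k \<longleftrightarrow> int s > int l - counts f (x, j)" if "s \<in> {1..l}" for s
    unfolding k by (rule above_iff_counts[OF f x that j])
  have U: "int s > int l - U \<longleftrightarrow>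
      (\<forall>y\<in>Q. x < y \<and> r y = r x + 1 \<longrightarrow> f (y, s) > k + 1) \<and> f (x, s) \<ge> k" if "s \<in> {1..l}" for s
    unfolding U_def k by (rule above_Min_iff[OF f x j that])
  have D: "int s > int l - D \<longleftrightarrow>
      (\<exists>y\<in>Q. y < x \<and> r x = r y + 1 \<and> f (y, s) \<ge> k) \<or> f (x, s) > k + 1" if "s \<in> {1..l}" for s
    unfolding D_def k by (rule above_Max_iff[OF f x j that])
  have nl: "next_label R x k = k + 1" using next_label_eq[OF x k_rng] .
  have act: "k \<in> R x" "\<exists>m\<in>R x. k < m" using k_rng
    by (auto simp: R_eq[OF x] intro!: bexI[of _ "k + 1"])
  have low: "free_low Q l R k f x = {s \<in> {1..l}. int l - U < int s \<and> int s \<le> int l - counts f (x, j)}"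
  proof (intro set_eqI)
    fix s
    show "s \<in> free_low Q l R k f x \<longleftrightarrow>
        s \<in> {s \<in> {1..l}. int l - U < int s \<and> int s \<le> int l - counts f (x, j)}"
    proof (cases "s \<in> {1..l}")
      case True
      have "s \<in> free_low Q l R k f x \<longleftrightarrow> f (x, s) = k \<and> raisable Q l R f x s"
        using True act by (auto simp: free_low_def)
      also have "\<dots> \<longleftrightarrow> f (x, s) = k \<and> (\<forall>y\<in>Q. x < y \<and> r y = r x + 1 \<longrightarrow> f (y, s) > k + 1)"
        using raisable_iff[OF f x True _ k_rng(2)] by blast
      also have "\<dots> \<longleftrightarrow> int l - U < int s \<and> \<not> f (x, s) > k" using U[OF True] by auto
      finally show ?thesis using G[OF True] True by auto
    qed (auto simp: free_low_def)
  qed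
  have high: "free_high Q l R k f x = {s \<in> {1..l}. int l - counts f (x, j) < int s \<and> int s \<le> int l - D}"
  proof (intro set_eqI)
    fix s
    show "s \<in> free_high Q l R k f x \<longleftrightarrow>
        s \<in> {s \<in> {1..l}. int l - counts f (x, j) < int s \<and> int s \<le> int l - D}"
    proof (cases "s \<in> {1..l}")
      case True
      have "s \<in> free_high Q l R k f x \<longleftrightarrow> f (x, s) = k + 1 \<and> lowerable Q l R f x s"
        using True act nl by (auto simp: free_high_def)
      also have "\<dots> \<longleftrightarrow> f (x, s) = k + 1 \<and> (\<forall>y\<in>Q. y < x \<and> r x = r y + 1 \<longrightarrow> f (y, s) < k)"
        using lowerable_iff[OF f x True _ k_rng(1)] by blast
      also have "\<dots> \<longleftrightarrow> f (x, s) > k \<and> \<not> int l - D < int s" using D[OF True] by (auto simp: not_le)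
      finally show ?thesis using G[OF True] True by auto
    qed (auto simp: free_high_def)
  qed
  let ?F = "free_low Q l R k f x \<union> free_high Q l R k f x"
  have F: "?F = {s \<in> {1..l}. int l - U < int s \<and> int s \<le> int l - D}"
    unfolding low high using order by auto
  have "free_high Q l R k f x = {nat (int l - counts f (x, j)) + 1..nat (int l - D)}"
    unfolding high using order by auto
  then have card_high: "int (card (free_high Q l R k f x)) = counts f (x, j) - D"
    using order by simp
  \<comment> \<open>The free block starts right after \<open>l - U\<close> and receives
    \<open>counts f (x, j) - D\<close> copies of \<open>k\<close>. They end at
    \<open>l - (U + D - counts f (x, j))\<close>, which is the boundary given by the toggled
    count.\<close>
  have card_below: "int (card {s \<in> ?F. s < t}) = int t - (int l - U + 1)" if "t \<in> ?F"
  proof -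
    have "{s \<in> ?F. s < t} = {nat (int l - U) + 1..<t}"
      unfolding F using order that by (auto simp: F)
    then have "card {s \<in> ?F. s < t} = t - (nat (int l - U) + 1)" by simp
    moreover have "nat (int l - U) + 1 \<le> t" using that order unfolding F by auto
    ultimately show ?thesis using order by (simp add: of_nat_diff)
  qed
  show "bender_knuth Q l R k f (x, t) =
    (if int l - U < int t \<and> int t \<le> int l - D
     then if int t \<le> int l - (U + D - counts f (x, j)) then k else k + 1 else f (x, t))"
  proof (cases "t \<in> ?F")
    case True
    have "card {s \<in> ?F. s < t} < card (free_high Q l R k f x) \<longleftrightarrow>
        int t \<le> int l - (U + D - counts f (x, j))"
      using card_below[OF True] card_high by linarith
    then have "bender_knuth Q l R k f (x, t) =
        (if int t \<le> int l - (U + D - counts f (x, j)) then k else k + 1)"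
      using True x nl by (simp add: bender_knuth_def Let_def)
    then show ?thesis using True by (simp add: F)
  next
    case False
    then have "bender_knuth Q l R k f (x, t) = f (x, t)"
      by (simp add: bender_knuth_def Let_def)
    then show ?thesis using False t by (auto simp: F)
  qed
  show "int l - U < int t \<and> int t \<le> int l - D \<longrightarrow> f (x, t) = k \<or> f (x, t) = k + 1"
    using U[OF t] D[OF t] by auto
qed

text \<open>In each fiber the involution only exchanges labels \<open>k\<close> and
  \<open>k + 1\<close>, so comparisons with a level other than \<open>k\<close> are unaffected. At
  level \<open>k\<close> the boundary is reflected, by \<open>bender_knuth_active\<close>.\<close>

lemma bender_knuth_toggle:
  assumes f: "f \<in> L"
  shows "bender_knuth Q l R k f \<in> L"
    and "counts (bender_knuth Q l R k f) = toggle cov (int l) {e \<in> E. lev e = k} (counts f)"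
proof -
  let ?f = "bender_knuth Q l R k f" and ?G = "toggle cov (int l) {e \<in> E. lev e = k} (counts f)"
  have G: "?G \<in> S"
    by (rule toggle_bounded_maps)
      (use finite_E cov_E counts_in[OF f] linked_lev in \<open>auto simp: linked_def\<close>)
  note old = above_iff_counts[OF f]
  have ext: "?f \<in> extensional (Q \<times> {1..l})"
    using labelingD(4)[OF f]
    by (auto simp: bender_knuth_def extensional_def free_low_def free_high_def Let_def)
  have "corresponds ?f ?G"
    unfolding corresponds_def
  proof (intro ballI conjI)
    fix x t assume x: "x \<in> Q" and t: "t \<in> {1..l}"
    have "?f (x, t) \<in> R x \<and> (\<forall>i\<in>{1..b}. lev (x, i) < ?f (x, t) \<longleftrightarrow> int l - ?G (x, i) < int t)"
    proof (cases "r x + 1 \<le> k \<and> k \<le> r x + int b")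
      case False
      have "?G (x, i) = counts f (x, i)" if "i \<in> {1..b}" for i
        using False that by (auto simp: toggle_def lev_def)
      then show ?thesis
        using bender_knuth_inactive[OF x False] old[OF x t] labelingD(3)[OF f x t] R_eq[OF x] by simp
    next
      case True
      then obtain j where j: "j \<in> {1..b}" "lev (x, j) = k" using lev_surj[of x k] by auto
      define U where "U = Min (insert (int l) (counts f ` {e. cov (x, j) e}))"
      define D where "D = Max (insert 0 (counts f ` {e. cov e (x, j)}))"
      note bk = bender_knuth_active[OF f x j(1) t j(2)[symmetric], folded U_def D_def]
      have xjE: "(x, j) \<in> E" using x j by (simp add: E_def)
      have order: "0 \<le> D" "D \<le> counts f (x, j)" "counts f (x, j) \<le> U" "U \<le> int l"
        unfolding U_def D_def
        using bounded_maps_extrema[of E cov "counts f" "int l" "(x, j)"]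
          finite_E cov_E counts_in[OF f] xjE by auto
      have Gj: "?G (x, j) = U + D - counts f (x, j)"
        using xjE j by (simp add: toggle_def U_def D_def)
      have Gi: "?G (x, i) = counts f (x, i)" if "i \<noteq> j" for i
        using that j by (auto simp: toggle_def lev_def)
      have "lev (x, i) < ?f (x, t) \<longleftrightarrow> int l - ?G (x, i) < int t" if i: "i \<in> {1..b}" for i
      proof (cases "i = j")
        case True
        show ?thesis
          using bk old[OF x t j(1)] order unfolding True Gj j(2) by (auto split: if_splits)
      next
        case False
        then have "lev (x, i) \<noteq> k" using j(2) by (auto simp: lev_def)
        then show ?thesis
          using bk old[OF x t i] unfolding Gi[OF False] by (auto split: if_splits)
      qed
      moreover have "?f (x, t) \<in> R x"
        using bk(1) True labelingD(3)[OF f x t] by (auto simp: R_eq[OF x])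
      ultimately show ?thesis by blast
    qed
    then show "?f (x, t) \<in> R x"
      and "\<And>i. i \<in> {1..b} \<Longrightarrow> lev (x, i) < ?f (x, t) \<longleftrightarrow> int l - ?G (x, i) < int t"
      by auto
  qed
  then show "?f \<in> L" "counts ?f = ?G"
    using corresponds_imp_labeling[OF ext G] corresponds_imp_counts[OF G] by auto
qed

text \<open>List \<open>E\<close> layer by layer in order of increasing level. Elements of one layer
  are unlinked, so the simultaneous toggle of a layer is a product of single ones.\<close>

lemma promotion_toggles:
  obtains xs where "distinct xs" "set xs = E" "height_sorted cov lev xs"
    and "\<And>f. f \<in> L \<Longrightarrow> promotion Q l R f \<in> L"
    and "\<And>f. f \<in> L \<Longrightarrow>
      counts (promotion Q l R f) = fold (\<lambda>e. toggle cov (int l) {e}) xs (counts f)"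
proof -
  obtain es where es: "set es = E" "distinct es"
    using finite_distinct_list[OF finite_E] by blast
  define layer where "layer k = filter (\<lambda>e. lev e = k) es" for k
  define row where "row ks = concat (map layer ks)" for ks
  have unlinked: "\<not> linked cov e f" if "e \<in> set (layer k)" "f \<in> set (layer k)" for e f k
    using that linked_lev[of e f] by (auto simp: layer_def)
  have layer_distinct: "distinct (layer k)" for k using es(2) by (simp add: layer_def)
  have row_set: "set (row ks) = {e \<in> E. lev e \<in> set ks}" for ks
    using es by (auto simp: row_def layer_def)
  have row_distinct: "distinct (row ks)" if "distinct ks" for ks
    using that
  proof (induction ks)
    case (Cons k ks)
    have "set (layer k) \<inter> set (row ks) = {}"
      using Cons.prems by (auto simp: row_set) (auto simp: layer_def)
    then show ?case using Cons es(2) by (simp add: row_def layer_def)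
  qed (simp add: row_def)
  have row_sorted: "height_sorted cov lev (row ks)" if "sorted_wrt (<) ks" for ks
    using that
  proof (induction ks)
    case (Cons k ks)
    have "height_sorted cov lev (layer k)"
      unfolding sorted_wrt_iff_nth_less by (meson unlinked nth_mem less_trans)
    moreover have "lev e < lev f" if "e \<in> set (layer k)" "f \<in> set (row ks)" for e f
      using that Cons.prems by (auto simp: row_set) (auto simp: layer_def)
    ultimately show ?case using Cons by (simp add: row_def sorted_wrt_append)
  qed (simp add: row_def)
  have bk: "fold (bender_knuth Q l R) ks f \<in> L \<and>
      counts (fold (bender_knuth Q l R) ks f) =
      fold (\<lambda>e. toggle cov (int l) {e}) (row ks) (counts f)" if "f \<in> L" for ks f
    using that
  proof (induction ks arbitrary: f)
    case (Cons k ks)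
    have "fold (\<lambda>e. toggle cov (int l) {e}) (layer k) (counts f) =
        toggle cov (int l) (set (layer k)) (counts f)"
      by (rule fold_toggle[OF layer_distinct unlinked])
    also have "set (layer k) = {e \<in> E. lev e = k}" using es(1) by (auto simp: layer_def)
    finally show ?case
      using Cons.IH[OF bender_knuth_toggle(1)[OF Cons.prems]] bender_knuth_toggle(2)[OF Cons.prems]
      by (simp add: row_def)
  qed (simp add: row_def)
  let ?ks = "[Min (\<Union>p\<in>Q. R p)..Max (\<Union>p\<in>Q. R p)]"
  have fin: "finite (\<Union>p\<in>Q. R p)" using finite_Q R_eq by auto
  \<comment> \<open>Each level is itself an allowed label, so the range of \<open>promotion\<close>
    misses no layer.\<close>
  have "lev e \<in> set ?ks" if "e \<in> E" for e
  proof -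
    obtain x j where e: "e = (x, j)" "x \<in> Q" "j \<in> {1..b}" using \<open>e \<in> E\<close> by (auto simp: E_def)
    then have "lev e \<in> R x" unfolding R_eq[OF e(2)] by (auto simp: lev_def)
    then have "lev e \<in> (\<Union>p\<in>Q. R p)" using e(2) by blast
    then show ?thesis using fin by simp
  qed
  then have "set (row ?ks) = E" by (auto simp: row_set)
  moreover have "distinct (row ?ks)" by (rule row_distinct) simp
  moreover have "height_sorted cov lev (row ?ks)" by (rule row_sorted) (rule sorted_wrt_upto)
  ultimately show thesis using that[of "row ?ks"] bk by (simp add: promotion_def)
qed

end

section \<open>Rank functions of graded posets\<close>

text \<open>The last two clauses say that minimal elements have rank \<open>0\<close> and maximal elements rank \<open>N\<close>.\<close>

definition rank_function :: "'q::order set \<Rightarrow> nat \<Rightarrow> ('q \<Rightarrow> int) \<Rightarrow> bool" where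
  "rank_function Q N r \<longleftrightarrow>
     (\<forall>x\<in>Q. 0 \<le> r x \<and> r x \<le> int N) \<and>
     (\<forall>x\<in>Q. \<forall>y\<in>Q. x < y \<longrightarrow> r x < r y) \<and>
     (\<forall>x\<in>Q. \<forall>y\<in>Q. x < y \<longrightarrow> (\<exists>z\<in>Q. x < z \<and> z \<le> y \<and> r z = r x + 1)) \<and>
     (\<forall>x\<in>Q. 0 < r x \<longrightarrow> (\<exists>y\<in>Q. y < x \<and> r y = r x - 1)) \<and>
     (\<forall>x\<in>Q. r x < int N \<longrightarrow> (\<exists>y\<in>Q. x < y \<and> r y = r x + 1))"

section \<open>Maximal chains in finite posets\<close>

lemma chain_iff:
  "pred_on.chain P (<) C \<longleftrightarrow> C \<subseteq> P \<and> (\<forall>x\<in>C. \<forall>y\<in>C. x < y \<or> x = y \<or> y < (x::'a::order))"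
  by (auto simp: pred_on.chain_def)

lemma extend_to_maxchain:
  assumes "finite P" and "pred_on.chain P (<) D"
  obtains C where "pred_on.maxchain P (<) C" and "D \<subseteq> (C :: 'a::order set)"
proof -
  let ?S = "{C. pred_on.chain P (<) C \<and> D \<subseteq> C}"
  have "finite ?S" by (rule finite_subset[of _ "Pow P"]) (use assms(1) in \<open>auto simp: chain_iff\<close>)
  moreover have "D \<in> ?S" using assms(2) by simp
  ultimately have "\<exists>C\<in>?S. \<forall>C'\<in>?S. C \<le> C' \<longrightarrow> C = C'"
    by (intro finite_has_maximal) auto
  then obtain C where C: "C \<in> ?S" "\<forall>C'\<in>?S. C \<le> C' \<longrightarrow> C = C'" ..
  have "\<not> (\<exists>S. pred_on.chain P (<) S \<and> C \<subset> S)"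
  proof
    assume "\<exists>S. pred_on.chain P (<) S \<and> C \<subset> S"
    then obtain S where S: "pred_on.chain P (<) S" "C \<subset> S" by auto
    then have "S \<in> ?S" using C(1) by auto
    then show False using C(2) S(2) by auto
  qed
  then have "pred_on.maxchain P (<) C"
    using C(1) unfolding pred_on.maxchain_def by auto
  then show thesis using that C(1) by auto
qed

lemma maxchain_memI:
  assumes "pred_on.maxchain P (<) C" and "z \<in> P" and "\<And>c. c \<in> C \<Longrightarrow> z < c \<or> z = c \<or> c < (z::'a::order)"
  shows "z \<in> C"
proof (rule ccontr)
  assume "z \<notin> C"
  moreover have "pred_on.chain P (<) (insert z C)"
    using assms(1,2) assms(3) by (auto simp: pred_on.maxchain_def chain_iff)
  moreover have "C \<subset> insert z C" if "z \<notin> C" using that by auto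
  ultimately show False using assms(1) by (simp add: pred_on.maxchain_def)
qed

text \<open>Let \<open>z\<close> be comparable with the whole spliced chain. If
  \<open>z < x\<close>, then \<open>z\<close> lies below the part of \<open>C\<close> from
  \<open>x\<close> on, so it is comparable with all of \<open>C\<close> and belongs to it by
  maximality. If \<open>x \<le> z\<close>, the same works with \<open>D\<close>.\<close>

lemma maxchain_splice:
  assumes C: "pred_on.maxchain P (<) C" and D: "pred_on.maxchain P (<) D" and x: "x \<in> C" "x \<in> D"
  shows "pred_on.maxchain P (<) ({c \<in> C. c < x} \<union> {c \<in> D. x \<le> (c::'a::order)})"
    (is "pred_on.maxchain P (<) ?M")
proof -
  have cC: "C \<subseteq> P" "\<And>c d. c \<in> C \<Longrightarrow> d \<in> C \<Longrightarrow> c < d \<or> c = d \<or> d < c"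
    and cD: "D \<subseteq> P" "\<And>c d. c \<in> D \<Longrightarrow> d \<in> D \<Longrightarrow> c < d \<or> c = d \<or> d < c"
    using C D unfolding pred_on.maxchain_def chain_iff by auto
  have chain: "pred_on.chain P (<) ?M"
    unfolding chain_iff
  proof (intro conjI ballI)
    show "?M \<subseteq> P" using cC(1) cD(1) by auto
    fix c d assume "c \<in> ?M" "d \<in> ?M"
    then consider "c \<in> C" "d \<in> C" | "c \<in> D" "d \<in> D" | "c < x" "x \<le> d" | "d < x" "x \<le> c"
      by auto
    then show "c < d \<or> c = d \<or> d < c"
      by cases (use cC(2) cD(2) in \<open>auto dest: order.strict_trans2\<close>)
  qed
  have "S \<subseteq> ?M" if S: "pred_on.chain P (<) S" "?M \<subseteq> S" for S
  proof
    fix z assume z: "z \<in> S"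
    have cmp: "z < c \<or> z = c \<or> c < z" if "c \<in> ?M" for c
      using S z that unfolding chain_iff by blast
    have zP: "z \<in> P" using S z by (auto simp: chain_iff)
    have "x \<in> ?M" using x by auto
    then consider "z < x" | "x \<le> z" using cmp[of x] by auto
    then show "z \<in> ?M"
    proof cases
      case 1
      have "z < c \<or> z = c \<or> c < z" if "c \<in> C" for c
        using cmp[of c] cC(2)[OF that x(1)] that 1 by (auto simp: order.order_iff_strict)
      then show ?thesis using maxchain_memI[OF C zP] 1 by auto
    next
      case 2
      have "z < c \<or> z = c \<or> c < z" if "c \<in> D" for c
        using cmp[of c] cD(2)[OF that x(2)] that 2 by (auto simp: order.order_iff_strict)
      then show ?thesis using maxchain_memI[OF D zP] 2 by auto
    qed
  qed
  then have "\<not> (\<exists>S. pred_on.chain P (<) S \<and> ?M \<subset> S)" by (simp add: psubset_eq) auto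
  then show ?thesis using chain unfolding pred_on.maxchain_def by simp
qed

text \<open>The rank of \<open>x\<close> is its position in a maximal chain; splicing two maximal chains through \<open>x\<close>
  at \<open>x\<close> shows that the choice of the chain does not matter.\<close>

lemma graded_imp_rank_function:
  assumes fin: "finite P" and graded: "graded_of_rank P n"
  shows "\<exists>r. rank_function (P::'a::order set) n r"
proof -
  have card: "card C = n + 1" if "pred_on.maxchain P (<) C" for C
    using graded that by (simp add: graded_of_rank_def)
  have sub: "C \<subseteq> P" "finite C" "\<And>c d. c \<in> C \<Longrightarrow> d \<in> C \<Longrightarrow> c < d \<or> c = d \<or> d < c"
    if "pred_on.maxchain P (<) C" for C
    using that fin finite_subset[of C P] unfolding pred_on.maxchain_def chain_iff by auto
  define r where "r x = int (card {c \<in> (SOME C. pred_on.maxchain P (<) C \<and> x \<in> C). c < x})" for x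
  have r: "r x = int (card {c \<in> C. c < x})" if C: "pred_on.maxchain P (<) C" and x: "x \<in> C" for x C
  proof -
    define D where "D = (SOME C. pred_on.maxchain P (<) C \<and> x \<in> C)"
    have D: "pred_on.maxchain P (<) D" "x \<in> D"
      using someI[of "\<lambda>C. pred_on.maxchain P (<) C \<and> x \<in> C" C] C x by (auto simp: D_def)
    have fin': "finite D" "finite C" using sub C D by auto
    \<comment> \<open>Both spliced chains are maximal, so they have equal size. They share the part
      from \<open>x\<close> on, so the parts below \<open>x\<close> have equal size too.\<close>
    have "card ({c \<in> C. c < x} \<union> {c \<in> D. x \<le> c}) = card ({c \<in> D. c < x} \<union> {c \<in> D. x \<le> c})"
      using card[OF maxchain_splice[OF C D(1) x D(2)]]
        card[OF maxchain_splice[OF D(1) D(1) D(2) D(2)]] by simp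
    also have "card ({c \<in> C. c < x} \<union> {c \<in> D. x \<le> c}) = card {c \<in> C. c < x} + card {c \<in> D. x \<le> c}"
      using fin' by (intro card_Un_disjoint) auto
    also have "card ({c \<in> D. c < x} \<union> {c \<in> D. x \<le> c}) = card {c \<in> D. c < x} + card {c \<in> D. x \<le> c}"
      using fin' by (intro card_Un_disjoint) auto
    finally show ?thesis by (simp add: r_def D_def)
  qed
  have through: "\<exists>C. pred_on.maxchain P (<) C \<and> x \<in> C \<and> y \<in> C"
    if "x \<in> P" "y \<in> P" "x \<le> y" for x y
  proof -
    have "pred_on.chain P (<) {x, y}" using that by (auto simp: chain_iff less_le)
    then obtain C where "pred_on.maxchain P (<) C" "{x, y} \<subseteq> C" by (rule extend_to_maxchain[OF fin])
    then show ?thesis by auto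
  qed
  have succ: "\<exists>z\<in>C. x < z \<and> z \<le> y \<and> r z = r x + 1"
    if C: "pred_on.maxchain P (<) C" and x: "x \<in> C" and y: "y \<in> C" and lt: "x < y" for C x y
  proof -
    have "finite {c \<in> C. x < c \<and> c \<le> y}" "y \<in> {c \<in> C. x < c \<and> c \<le> y}"
      using sub[OF C] y lt by auto
    \<comment> \<open>\<open>z\<close> is the immediate successor of \<open>x\<close> in the chain
      \<open>C\<close>.\<close>
    then obtain z where z: "z \<in> C" "x < z" "z \<le> y"
      and min: "\<And>c. c \<in> C \<Longrightarrow> x < c \<Longrightarrow> c \<le> y \<Longrightarrow> c \<le> z \<Longrightarrow> c = z"
      using finite_has_minimal[of "{c \<in> C. x < c \<and> c \<le> y}"] by blast
    have "{c \<in> C. c < z} = insert x {c \<in> C. c < x}"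
    proof (intro equalityI subsetI)
      fix c assume c: "c \<in> {c \<in> C. c < z}"
      then show "c \<in> insert x {c \<in> C. c < x}"
        using min[of c] z sub(3)[OF C _ x, of c] by force
    qed (use x z in auto)
    then have "r z = r x + 1" using r[OF C z(1)] r[OF C x] sub(2)[OF C] by simp
    then show ?thesis using z by auto
  qed
  have pred: "\<exists>y\<in>C. y < x \<and> r y = r x - 1"
    if C: "pred_on.maxchain P (<) C" and x: "x \<in> C" and pos: "0 < r x" for C x
  proof -
    have "{c \<in> C. c < x} \<noteq> {}" "finite {c \<in> C. c < x}"
      using pos r[OF C x] sub(2)[OF C] by (auto simp: card_gt_0_iff)
    then obtain y where y: "y \<in> C" "y < x" and max: "\<And>c. c \<in> C \<Longrightarrow> c < x \<Longrightarrow> y \<le> c \<Longrightarrow> c = y"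
      using finite_has_maximal[of "{c \<in> C. c < x}"] by blast
    from succ[OF C y(1) x y(2)] obtain z where z: "z \<in> C" "y < z" "z \<le> x" "r z = r y + 1" by auto
    then have "z = x" using max[of z] by force
    then show ?thesis using y z by auto
  qed
  have next': "\<exists>y\<in>C. x < y"
    if C: "pred_on.maxchain P (<) C" and x: "x \<in> C" and less: "r x < int n" for C x
  proof (rule ccontr)
    assume "\<not> ?thesis"
    \<comment> \<open>Otherwise \<open>x\<close> would be the top of \<open>C\<close>, which would
      then have only \<open>r x + 1\<close> elements, fewer than \<open>n + 1\<close>.\<close>
    then have "C = insert x {c \<in> C. c < x}" using sub(3)[OF C _ x] x by blast
    then have "card C = card {c \<in> C. c < x} + 1" using sub(2)[OF C]
      by (metis (no_types, lifting) card_insert_disjoint finite_insert less_irrefl mem_Collect_eq Suc_eq_plus1)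
    then show False using card[OF C] r[OF C x] less by simp
  qed
  have bound: "r x \<le> int n" if C: "pred_on.maxchain P (<) C" and x: "x \<in> C" for C x
  proof -
    have "card {c \<in> C. c < x} < card C" using sub(2)[OF C] x by (intro psubset_card_mono) auto
    then show ?thesis using card[OF C] r[OF C x] by simp
  qed
  have mono: "r x < r y" if C: "pred_on.maxchain P (<) C" and x: "x \<in> C" "y \<in> C" "x < y" for C x y
  proof -
    have "card {c \<in> C. c < x} < card {c \<in> C. c < y}"
      using sub(2)[OF C] x by (intro psubset_card_mono) auto
    then show ?thesis using r[OF C x(1)] r[OF C x(2)] by simp
  qed
  have "rank_function P n r"
    unfolding rank_function_def
  proof (intro conjI ballI impI)
    fix x assume x: "x \<in> P"
    obtain C where C: "pred_on.maxchain P (<) C" "x \<in> C" using through[OF x x] by auto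
    show "0 \<le> r x" by (simp add: r_def)
    show "r x \<le> int n" using bound C by blast
    show "\<exists>y\<in>P. y < x \<and> r y = r x - 1" if "0 < r x"
      using pred[OF C that] sub(1)[OF C(1)] by blast
    show "\<exists>y\<in>P. x < y \<and> r y = r x + 1" if "r x < int n"
      using next'[OF C that] succ[OF C] sub(1)[OF C(1)] by blast
    fix y assume y: "y \<in> P" "x < y"
    then obtain D where D: "pred_on.maxchain P (<) D" "x \<in> D" "y \<in> D"
      using through[OF x] by (meson less_imp_le)
    show "r x < r y" using mono D y by blast
    show "\<exists>z\<in>P. x < z \<and> z \<le> y \<and> r z = r x + 1"
      using succ[OF D y(2)] sub(1)[OF D(1)] by blast
  qed
  then show ?thesis by blast
qed

text \<open>Ranks add up; the \<open>- 1\<close> compensates for \<open>{1..a}\<close> starting at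
  1. A step up or down changes the chain coordinate unless it is already extreme, and then the
  coordinate in \<open>P\<close>.\<close>

lemma rank_function_times:
  assumes r: "rank_function (P::'a::order set) n r" and a: "a \<ge> 1"
  shows "rank_function (P \<times> {1..a}) (n + a - 1) (\<lambda>(p, i). r p + int i - 1)"
  unfolding rank_function_def
proof (intro conjI ballI impI; clarify)
  have rng: "\<And>p. p \<in> P \<Longrightarrow> 0 \<le> r p \<and> r p \<le> int n"
    and mono: "\<And>p q. p \<in> P \<Longrightarrow> q \<in> P \<Longrightarrow> p < q \<Longrightarrow> r p < r q"
    and step: "\<And>p q. p \<in> P \<Longrightarrow> q \<in> P \<Longrightarrow> p < q \<Longrightarrow> \<exists>z\<in>P. p < z \<and> z \<le> q \<and> r z = r p + 1"
    and down: "\<And>p. p \<in> P \<Longrightarrow> 0 < r p \<Longrightarrow> \<exists>q\<in>P. q < p \<and> r q = r p - 1"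
    and up: "\<And>p. p \<in> P \<Longrightarrow> r p < int n \<Longrightarrow> \<exists>q\<in>P. p < q \<and> r q = r p + 1"
    using r unfolding rank_function_def by blast+
  fix p i assume p: "p \<in> P" and i: "i \<in> {1..a}"
  show "0 \<le> r p + int i - 1" using rng[OF p] i by auto
  show "r p + int i - 1 \<le> int (n + a - 1)" using rng[OF p] i by auto
  show "\<exists>y\<in>P \<times> {1..a}. y < (p, i) \<and> (case y of (p, i) \<Rightarrow> r p + int i - 1) = r p + int i - 1 - 1"
    if pos: "0 < r p + int i - 1"
  proof (cases "i = 1")
    case True
    then obtain q where "q \<in> P" "q < p" "r q = r p - 1" using down[OF p] pos by auto
    then show ?thesis using True i by (intro bexI[of _ "(q, i)"]) (auto simp: less_prod_def)
  next
    case False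
    then show ?thesis using p i by (intro bexI[of _ "(p, i - 1)"]) (auto simp: less_prod_def)
  qed
  show "\<exists>y\<in>P \<times> {1..a}. (p, i) < y \<and> (case y of (p, i) \<Rightarrow> r p + int i - 1) = r p + int i - 1 + 1"
    if less: "r p + int i - 1 < int (n + a - 1)"
  proof (cases "i = a")
    case True
    then have "r p < int n" using less i by auto
    then obtain q where "q \<in> P" "p < q" "r q = r p + 1" using up[OF p] by auto
    then show ?thesis using i by (intro bexI[of _ "(q, i)"]) (auto simp: less_prod_def)
  next
    case False
    then show ?thesis using p i by (intro bexI[of _ "(p, i + 1)"]) (auto simp: less_prod_def)
  qed
  fix q j assume q: "q \<in> P" and j: "j \<in> {1..a}" and lt: "(p, i) < (q, j)"
  show "r p + int i - 1 < r q + int j - 1"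
    using lt mono[OF p q] by (cases "p = q") (auto simp: less_prod_def order.strict_iff_order)
  show "\<exists>z\<in>P \<times> {1..a}. (p, i) < z \<and> z \<le> (q, j) \<and>
      (case z of (p, i) \<Rightarrow> r p + int i - 1) = r p + int i - 1 + 1"
  proof (cases "p = q")
    case True
    then show ?thesis using lt p i j by (intro bexI[of _ "(p, i + 1)"]) (auto simp: less_prod_def)
  next
    case False
    then have "p < q" "i \<le> j" using lt by (auto simp: less_prod_def)
    then obtain z where "z \<in> P" "p < z" "z \<le> q" "r z = r p + 1" using step[OF p q] by blast
    then show ?thesis using i \<open>i \<le> j\<close> by (intro bexI[of _ "(z, i)"]) (auto simp: less_prod_def)
  qed
qed

text \<open>Descending to rank 0 bounds a strict map from below, and climbing to rank
  \<open>N\<close> bounds it from above.\<close>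

lemma restriction_upto_rank_function:
  assumes r: "rank_function Q N r" and x: "x \<in> Q" and q: "q = N + 1 + b"
  shows "restriction_upto Q q x = {r x + 1..r x + 1 + int b}"
proof (intro equalityI subsetI)
  have rng: "\<And>p. p \<in> Q \<Longrightarrow> 0 \<le> r p \<and> r p \<le> int N"
    and mono: "\<And>p q. p \<in> Q \<Longrightarrow> q \<in> Q \<Longrightarrow> p < q \<Longrightarrow> r p < r q"
    and down: "\<And>p. p \<in> Q \<Longrightarrow> 0 < r p \<Longrightarrow> \<exists>q\<in>Q. q < p \<and> r q = r p - 1"
    and up: "\<And>p. p \<in> Q \<Longrightarrow> r p < int N \<Longrightarrow> \<exists>q\<in>Q. p < q \<and> r q = r p + 1"
    using r unfolding rank_function_def by blast+
  {
    fix k assume "k \<in> restriction_upto Q q x"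
    then obtain g where g: "\<And>y. y \<in> Q \<Longrightarrow> 1 \<le> g y \<and> g y \<le> int q"
      "\<And>y z. y \<in> Q \<Longrightarrow> z \<in> Q \<Longrightarrow> y < z \<Longrightarrow> g y < g z" and k: "k = g x"
      unfolding restriction_upto_def by (auto 4 3)
    have low: "r y + 1 \<le> g y" if "y \<in> Q" for y
      using that
    proof (induction "nat (r y)" arbitrary: y)
      case 0
      then show ?case using rng[of y] g(1)[of y] by auto
    next
      case (Suc m)
      have "0 < r y" using Suc.hyps(2) by linarith
      then obtain z where z: "z \<in> Q" "z < y" "r z = r y - 1" using down[OF Suc.prems] by auto
      have "m = nat (r z)" using z(3) Suc.hyps(2) by linarith
      then have "r z + 1 \<le> g z" using Suc.hyps(1) z(1) by blast
      then show ?case using g(2)[of z y] z Suc.prems by auto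
    qed
    have high: "g y \<le> r y + 1 + int b" if "y \<in> Q" for y
      using that
    proof (induction "nat (int N - r y)" arbitrary: y)
      case 0
      then show ?case using rng[of y] g(1)[of y] q by auto
    next
      case (Suc m)
      have "r y < int N" using Suc.hyps(2) by linarith
      then obtain z where z: "z \<in> Q" "y < z" "r z = r y + 1" using up[OF Suc.prems] by auto
      have "m = nat (int N - r z)" using z(3) Suc.hyps(2) by linarith
      then have "g z \<le> r z + 1 + int b" using Suc.hyps(1) z(1) by blast
      then show ?case using g(2)[of y z] z Suc.prems by auto
    qed
    show "k \<in> {r x + 1..r x + 1 + int b}" using low[OF x] high[OF x] k by auto
  next
    fix k assume "k \<in> {r x + 1..r x + 1 + int b}"
    then show "k \<in> restriction_upto Q q x"
      unfolding restriction_upto_def using rng mono q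
      \<comment> \<open>The rank shifted by a constant to take the value \<open>k\<close> at
        \<open>x\<close>. The shift lies between 1 and \<open>b + 1\<close>, so the values stay
        within \<open>1\<close> and \<open>N + 1 + b\<close>.\<close>
      by (intro CollectI exI[of _ "\<lambda>y. r y + (k - r x)"]) fastforce
  }
qed

section \<open>Exchanging the two chain factors\<close>

lemma rank_function_graded_labelings:
  assumes "finite Q" "rank_function Q N r" "q = N + 1 + b"
  shows "graded_labelings Q r (restriction_upto Q q) b"
proof
  fix x assume "x \<in> Q"
  then show "restriction_upto Q q x = {r x + 1..r x + 1 + int b}"
    using assms by (intro restriction_upto_rank_function)
qed (use assms in \<open>auto simp: rank_function_def\<close>)

text \<open>If \<open>p < q\<close>, the first rank already uses up the total increase of one, so
  the chain coordinate cannot move.\<close>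

lemma cover_times_iff:
  assumes "rank_function P n r" "p \<in> P" "q \<in> P"
  shows "(p, i) < (q, i') \<and> r q + int i' = r p + int i + 1 \<longleftrightarrow>
    p < q \<and> r q = r p + 1 \<and> i' = i \<or> q = p \<and> i' = i + 1"
proof (cases "p < q")
  case True
  then have "r p < r q" using assms by (auto simp: rank_function_def)
  then show ?thesis using True by (auto simp: less_prod_def)
next
  case False
  then show ?thesis by (auto simp: less_prod_def less_le)
qed

text \<open>Identifies \<open>(P \<times> {1..a}) \<times> {1..b}\<close> with
  \<open>(P \<times> {1..b}) \<times> {1..a}\<close>; the same function serves in both
  directions.\<close>

definition swap_coords :: "('a \<times> nat) \<times> nat \<Rightarrow> ('a \<times> nat) \<times> nat" where
  "swap_coords = (\<lambda>((p, i), j). ((p, j), i))"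

lemma swap_coords_swap_coords [simp]: "swap_coords (swap_coords e) = e"
  by (auto simp: swap_coords_def split: prod.splits)

section \<open>Transport of toggles along the swap\<close>

lemma toggle_swap_coords:
  assumes cov: "\<And>e f. cov' (swap_coords e) (swap_coords f) \<longleftrightarrow> cov e f"
  shows "toggle cov' l {swap_coords e} (G \<circ> swap_coords) = toggle cov l {e} G \<circ> swap_coords"
proof
  fix g
  have cov': "cov' e f \<longleftrightarrow> cov (swap_coords e) (swap_coords f)" for e f
    using cov[of "swap_coords e" "swap_coords f"] by simp
  have "{f. cov' (swap_coords e) f} = swap_coords ` {f. cov e f}"
    "{f. cov' f (swap_coords e)} = swap_coords ` {f. cov f e}"
    by (auto simp: cov' intro!: image_eqI[of _ swap_coords "swap_coords _"])
  then have "(G \<circ> swap_coords) ` {f. cov' (swap_coords e) f} = G ` {f. cov e f}"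
    "(G \<circ> swap_coords) ` {f. cov' f (swap_coords e)} = G ` {f. cov f e}"
    by (simp_all only: image_image o_apply swap_coords_swap_coords)
  moreover have "swap_coords g \<noteq> e" if "g \<noteq> swap_coords e" using that by auto
  ultimately show "toggle cov' l {swap_coords e} (G \<circ> swap_coords) g =
      (toggle cov l {e} G \<circ> swap_coords) g"
    by (cases "g = swap_coords e") (simp_all add: toggle_def)
qed

lemma fold_toggle_swap_coords:
  assumes "\<And>e f. cov' (swap_coords e) (swap_coords f) \<longleftrightarrow> cov e f"
  shows "fold (\<lambda>e. toggle cov' l {e}) (map swap_coords es) (G \<circ> swap_coords) =
    fold (\<lambda>e. toggle cov l {e}) es G \<circ> swap_coords"
  by (induction es arbitrary: G) (simp_all add: toggle_swap_coords[of cov' cov, OF assms])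

lemma bounded_maps_swap_coords:
  assumes "G \<in> bounded_maps cov k E"
    and cov: "\<And>e f. cov' (swap_coords e) (swap_coords f) \<longleftrightarrow> cov e f"
    and E: "\<And>e. swap_coords e \<in> E' \<longleftrightarrow> e \<in> E"
  shows "G \<circ> swap_coords \<in> bounded_maps cov' k E'"
proof -
  have "cov' e f \<longleftrightarrow> cov (swap_coords e) (swap_coords f)" "e \<in> E' \<longleftrightarrow> swap_coords e \<in> E" for e f
    using cov[of "swap_coords e" "swap_coords f"] E[of "swap_coords e"] by simp_all
  then show ?thesis using assms(1) by (simp add: bounded_maps_def del: split_paired_All)
qed

theorem theorem3p9:
  fixes P :: "'a::order set" and n a b l :: nat
  assumes "finite P" and "graded_of_rank P n"
    and "a \<ge> 1" and "b \<ge> 1" and "l \<ge> 1"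
  defines "A \<equiv> P \<times> {1..a}" and "B \<equiv> P \<times> {1..b}"
  defines "RA \<equiv> restriction_upto A (a + b + n)" and "RB \<equiv> restriction_upto B (a + b + n)"
  shows "\<exists>\<Psi>. bij_betw \<Psi> (strict_labelings A l RA) (strict_labelings B l RB) \<and>
    (\<forall>f\<in>strict_labelings A l RA. \<Psi> (promotion A l RA f) = promotion B l RB (\<Psi> f))"
proof -
  obtain r where r: "rank_function P n r"
    using graded_imp_rank_function assms(1,2) by blast
  \<comment> \<open>Here \<open>N = n + a - 1\<close>, so \<open>a + b + n = N + 1 + b\<close>
    leaves slack \<open>b\<close>. For \<open>B\<close> the roles of \<open>a\<close> and
    \<open>b\<close> are exchanged.\<close>
  interpret A: graded_labelings A "\<lambda>(p, i). r p + int i - 1" RA b l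
    unfolding A_def RA_def using assms(1,3)
    by (intro rank_function_graded_labelings[OF _ rank_function_times[OF r]]) auto
  interpret B: graded_labelings B "\<lambda>(p, i). r p + int i - 1" RB a l
    unfolding B_def RB_def using assms(1,4)
    by (intro rank_function_graded_labelings[OF _ rank_function_times[OF r]]) auto
  let ?s = "swap_coords :: ('a \<times> nat) \<times> nat \<Rightarrow> _"
  \<comment> \<open>Both relations say that exactly one of the three coordinates moves up by one
    cover.\<close>
  have cov: "B.cov (?s e) (?s f) \<longleftrightarrow> A.cov e f" for e f
  proof -
    obtain p i j q i' j' where e: "e = ((p, i), j)" and f: "f = ((q, i'), j')" by (metis surj_pair)
    show ?thesis
    proof (cases "p \<in> P \<and> q \<in> P")
      case True
      then have step: "((p, i) < (q, i') \<and> r q + int i' - 1 = r p + int i - 1 + 1 \<and> X) \<longleftrightarrow>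
          (p < q \<and> r q = r p + 1 \<and> i' = i \<or> q = p \<and> i' = i + 1) \<and> X" for i i' X
        using cover_times_iff[OF r, of p q i i'] by (auto simp: algebra_simps)
      show ?thesis
        using True unfolding e f swap_coords_def A.cov_def B.cov_def prod.case step
        by (auto simp: A_def B_def)
    next
      case False
      then show ?thesis
        unfolding e f swap_coords_def A.cov_def B.cov_def prod.case by (auto simp: A_def B_def)
    qed
  qed
  have swap_E: "?s e \<in> B.E \<longleftrightarrow> e \<in> A.E" for e
    unfolding A.E_def B.E_def by (auto simp: swap_coords_def A_def B_def split: prod.splits)
  have cov': "A.cov (?s e) (?s f) \<longleftrightarrow> B.cov e f" and swap_E': "?s e \<in> A.E \<longleftrightarrow> e \<in> B.E" for e f
    using cov[of "?s e" "?s f"] swap_E[of "?s e"] by simp_all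
  have swap_bij: "bij_betw (\<lambda>G. G \<circ> ?s) A.S B.S"
  proof (rule bij_betw_byWitness[where f' = "\<lambda>G. G \<circ> ?s"])
    have id: "(G \<circ> ?s) \<circ> ?s = G" for G :: "_ \<Rightarrow> int" by (simp add: fun_eq_iff)
    show "\<forall>G\<in>A.S. G \<circ> ?s \<circ> ?s = G" "\<forall>G\<in>B.S. G \<circ> ?s \<circ> ?s = G" by (simp_all add: id)
    show "(\<lambda>G. G \<circ> ?s) ` A.S \<subseteq> B.S" by (rule image_subsetI, erule bounded_maps_swap_coords) (rule cov swap_E)+
    show "(\<lambda>G. G \<circ> ?s) ` B.S \<subseteq> A.S" by (rule image_subsetI, erule bounded_maps_swap_coords) (rule cov' swap_E')+
  qed
  obtain xs where xs: "distinct xs" "set xs = A.E" "height_sorted A.cov A.lev xs"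
    and pro_A: "\<And>f. f \<in> A.L \<Longrightarrow> promotion A l RA f \<in> A.L"
      "\<And>f. f \<in> A.L \<Longrightarrow> A.counts (promotion A l RA f) =
        fold (\<lambda>e. toggle A.cov (int l) {e}) xs (A.counts f)"
    by (rule A.promotion_toggles) blast
  obtain ys where ys: "distinct ys" "set ys = B.E" "height_sorted B.cov B.lev ys"
    and pro_B: "\<And>f. f \<in> B.L \<Longrightarrow> promotion B l RB f \<in> B.L"
      "\<And>f. f \<in> B.L \<Longrightarrow> B.counts (promotion B l RB f) =
        fold (\<lambda>e. toggle B.cov (int l) {e}) ys (B.counts f)"
    by (rule B.promotion_toggles) blast
  \<comment> \<open>The height of the second product, shifted by a constant, which does not affect
    sortedness. The term \<open>int b - int a\<close> makes the difference to \<open>A.lev\<close>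
    even, and \<open>2 * (int a + int b)\<close> makes it nonnegative on \<open>A.E\<close>.\<close>
  define \<psi> where "\<psi> e = B.lev (?s e) + (int b - int a) + 2 * (int a + int b)" for e
  have \<psi>: "\<psi> e - A.lev e = 2 * (int (snd e) - int (snd (fst e)) + int a + int b)" for e
    by (auto simp: \<psi>_def A.lev_def B.lev_def swap_coords_def split: prod.splits)
  have "\<exists>\<Theta>. bij_betw \<Theta> A.S A.S \<and> (\<forall>G\<in>A.S. \<Theta> (fold (\<lambda>e. toggle A.cov (int l) {e}) xs G) =
      fold (\<lambda>e. toggle A.cov (int l) {e}) (map ?s ys) (\<Theta> G))"
  proof (rule toggle_products_conjugate[where \<phi> = A.lev and \<psi> = \<psi>])
    show "\<bar>\<psi> e - \<psi> f\<bar> = 1" if "A.cov e f" for e f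
      using B.cov_lev[of "?s e" "?s f"] that by (simp add: cov \<psi>_def)
    show "A.lev e \<le> \<psi> e" if "e \<in> A.E" for e
    proof -
      have "0 \<le> \<psi> e - A.lev e" using that unfolding A.E_def by (auto simp: \<psi> A_def)
      then show ?thesis by simp
    qed
    show "even (\<psi> e - A.lev e)" for e by (simp add: \<psi>)
    show "distinct (map ?s ys)"
      using ys(1) by (auto simp: distinct_map intro!: inj_on_inverseI[of _ ?s])
    show "set (map ?s ys) = A.E"
      using swap_E ys(2) by (auto intro!: image_eqI[of _ ?s "?s _"]) (metis swap_coords_swap_coords)
    have "linked B.cov e f \<longleftrightarrow> linked A.cov (?s e) (?s f)" for e f
      using cov[of "?s e" "?s f"] cov[of "?s f" "?s e"] by (simp add: linked_def)
    then show "height_sorted A.cov \<psi> (map ?s ys)"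
      using ys(3) by (simp add: sorted_wrt_map \<psi>_def)
  qed (use A.finite_E A.cov_E A.cov_lev xs in auto)
  then obtain \<Theta> where \<Theta>: "bij_betw \<Theta> A.S A.S"
    and conj: "\<And>G. G \<in> A.S \<Longrightarrow> \<Theta> (fold (\<lambda>e. toggle A.cov (int l) {e}) xs G) =
      fold (\<lambda>e. toggle A.cov (int l) {e}) (map ?s ys) (\<Theta> G)"
    by blast
  \<comment> \<open>Pass to counts, conjugate one order of the toggles into the other, swap the
    chain coordinates, and read the result as a labeling of the second poset.\<close>
  define \<Psi> where "\<Psi> = inv_into B.L B.counts \<circ> ((\<lambda>G. G \<circ> ?s) \<circ> (\<Theta> \<circ> A.counts))"
  have to_B: "bij_betw ((\<lambda>G. G \<circ> ?s) \<circ> (\<Theta> \<circ> A.counts)) A.L B.S"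
    by (intro bij_betw_trans[OF _ swap_bij] bij_betw_trans[OF A.counts_bij \<Theta>])
  have bij: "bij_betw \<Psi> A.L B.L"
    unfolding \<Psi>_def by (rule bij_betw_trans[OF to_B bij_betw_inv_into[OF B.counts_bij]])
  have counts_\<Psi>: "B.counts (\<Psi> f) = \<Theta> (A.counts f) \<circ> ?s" if "f \<in> A.L" for f
    using bij_betw_inv_into_right[OF B.counts_bij bij_betw_apply[OF to_B that]] by (simp add: \<Psi>_def)
  have "\<Psi> (promotion A l RA f) = promotion B l RB (\<Psi> f)" if f: "f \<in> A.L" for f
  proof (rule inj_onD[OF bij_betw_imp_inj_on[OF B.counts_bij]])
    have \<Psi>f: "\<Psi> f \<in> B.L" using bij_betw_apply[OF bij f] .
    show "\<Psi> (promotion A l RA f) \<in> B.L" using bij_betw_apply[OF bij pro_A(1)[OF f]] .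
    show "promotion B l RB (\<Psi> f) \<in> B.L" using pro_B(1)[OF \<Psi>f] .
    have "B.counts (\<Psi> (promotion A l RA f)) =
        fold (\<lambda>e. toggle A.cov (int l) {e}) (map ?s ys) (\<Theta> (A.counts f)) \<circ> ?s"
      using f by (simp only: counts_\<Psi> pro_A conj A.counts_in)
    also have "\<dots> = fold (\<lambda>e. toggle B.cov (int l) {e}) (map ?s (map ?s ys)) (B.counts (\<Psi> f))"
      unfolding counts_\<Psi>[OF f] by (rule fold_toggle_swap_coords[symmetric]) (rule cov)
    also have "map ?s (map ?s ys) = ys" by (simp add: o_def)
    finally show "B.counts (\<Psi> (promotion A l RA f)) = B.counts (promotion B l RB (\<Psi> f))"
      by (simp only: pro_B(2)[OF \<Psi>f])
  qed
  with bij show ?thesis by blast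
qed

end
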